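(* Let $A$ be a ring with center $C$ and let $n$ be a positive integer. The following conditions are equivalent: 1) $\Lambda(A^n)$ is a centrally essential ring. 2) $A$ is a centrally essential ring and at least one of the following conditions holds: (a) the ideal $\mathrm{Ann}_A(2)$ is an essential submodule of the module $A_C$; (b) $n$ is an odd integer.
   Context: All rings are associative and unital, not necessarily commutative. A ring $R$ with center $C(R)$ is called centrally essential if the right $C(R)$-module $R_{C(R)}$ is an essential extension of its submodule $C(R)_{C(R)}$; equivalently, for every nonzero $r\in R$ there is $c\in C(R)$ with $0\neq rc\in C(R)$. For a ring $A$ with center $C$ and a positive integer $n$, the exterior algebra of the free module $A^n$ is defined as the ring $\Lambda(A^n)=A\otimes_C\Lambda(C^n)$, where $\Lambda(C^n)$ is the usual exterior algebra of the free module $C^n$ over the commutative ring $C$ (so that, if $e_1,\dots,e_n$ is a basis of $C^n$, then $e_i\wedge e_i=0$, $e_i\wedge e_j=-e_j\wedge e_i$, the products $e_{i_1}\wedge\ldots\wedge e_{i_s}$ with $0\le s\le n$, $1\le i_1<\ldots<i_s\le n$ form a basis of $\Lambda(A^n)$ over $A$, and elements of $A$ commute with the $e_i$). $\mathrm{Ann}_A(2)=\{a\in A: 2a=0\}$. $A_C$ denotes $A$ regarded as a right module over its center $C$. *)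

theory Defs
  imports "HOL-Algebra.IntRing" "HOL-Algebra.Module"
begin

section \<open>The center and central essentiality\<close>

definition center_set :: "('a, 'm) ring_scheme \<Rightarrow> 'a set"
  where "center_set R = {c \<in> carrier R. \<forall>x \<in> carrier R. c \<otimes>\<^bsub>R\<^esub> x = x \<otimes>\<^bsub>R\<^esub> c}"

definition center_ring :: "('a, 'm) ring_scheme \<Rightarrow> ('a, 'm) ring_scheme"
  where "center_ring R = R\<lparr>carrier := center_set R\<rparr>"

text \<open>The right module of \<open>R\<close> over its center. The library writes scalars on the left, which is
  harmless because the center is commutative. The ring operations of \<open>R\<close> are kept, so that this is
  also \<open>R\<close> as an algebra over its center.\<close>

definition center_module :: "('a, 'm) ring_scheme \<Rightarrow> ('a, 'a) module"
  where "center_module R =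
    \<lparr>carrier = carrier R, mult = mult R, one = one R, zero = zero R, add = add R,
     smult = (\<lambda>c x. x \<otimes>\<^bsub>R\<^esub> c)\<rparr>"

definition essential_submodule ::
    "'b set \<Rightarrow> ('a, 'm) ring_scheme \<Rightarrow> ('a, 'b, 'n) module_scheme \<Rightarrow> bool"
  where "essential_submodule N K M \<longleftrightarrow>
    submodule N K M \<and>
    (\<forall>L. submodule L K M \<and> L \<noteq> {\<zero>\<^bsub>M\<^esub>} \<longrightarrow> N \<inter> L \<noteq> {\<zero>\<^bsub>M\<^esub>})"

definition centrally_essential :: "('a, 'm) ring_scheme \<Rightarrow> bool"
  where "centrally_essential R \<longleftrightarrow>
    essential_submodule (center_set R) (center_ring R) (center_module R)"

definition annihilator_of_two :: "('a, 'm) ring_scheme \<Rightarrow> 'a set"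
  where "annihilator_of_two R = {a \<in> carrier R. [(2::nat)] \<cdot>\<^bsub>R\<^esub> a = \<zero>\<^bsub>R\<^esub>}"


section \<open>Monoid algebras and quotient algebras\<close>

text \<open>Elements are the finitely supported functions from the monoid \<open>M\<close> to \<open>K\<close>, extended by zero
  outside the carrier of \<open>M\<close>; multiplication is convolution.\<close>

definition monoid_algebra ::
    "('k, 'm) ring_scheme \<Rightarrow> ('w, 'n) monoid_scheme \<Rightarrow> ('k, 'w \<Rightarrow> 'k) module"
  where "monoid_algebra K M =
    \<lparr>carrier = {f. (\<forall>w. f w \<in> carrier K) \<and> (\<forall>w. w \<notin> carrier M \<longrightarrow> f w = \<zero>\<^bsub>K\<^esub>) \<and>
                   finite {w. f w \<noteq> \<zero>\<^bsub>K\<^esub>}},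
     mult = (\<lambda>f g w. \<Oplus>\<^bsub>K\<^esub>p \<in> {p. f (fst p) \<noteq> \<zero>\<^bsub>K\<^esub> \<and> g (snd p) \<noteq> \<zero>\<^bsub>K\<^esub> \<and> fst p \<otimes>\<^bsub>M\<^esub> snd p = w}.
                      f (fst p) \<otimes>\<^bsub>K\<^esub> g (snd p)),
     one = (\<lambda>w. if w = \<one>\<^bsub>M\<^esub> then \<one>\<^bsub>K\<^esub> else \<zero>\<^bsub>K\<^esub>),
     zero = (\<lambda>w. \<zero>\<^bsub>K\<^esub>),
     add = (\<lambda>f g w. f w \<oplus>\<^bsub>K\<^esub> g w),
     smult = (\<lambda>c f w. c \<otimes>\<^bsub>K\<^esub> f w)\<rparr>"

definition basis_elt :: "('k, 'm) ring_scheme \<Rightarrow> 'w \<Rightarrow> 'w \<Rightarrow> 'k"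
  where "basis_elt K v = (\<lambda>w. if w = v then \<one>\<^bsub>K\<^esub> else \<zero>\<^bsub>K\<^esub>)"

definition quotient_algebra :: "('k, 'b, 'n) module_scheme \<Rightarrow> 'b set \<Rightarrow> ('k, 'b set) module"
  where "quotient_algebra T I =
    \<lparr>carrier = carrier (T Quot I), mult = mult (T Quot I), one = one (T Quot I),
     zero = zero (T Quot I), add = add (T Quot I),
     smult = (\<lambda>c X. \<Union>x \<in> X. I +>\<^bsub>T\<^esub> (c \<odot>\<^bsub>T\<^esub> x))\<rparr>"


section \<open>The exterior algebra of a module over a commutative ring\<close>

definition word_monoid :: "'a set \<Rightarrow> 'a list monoid"
  where "word_monoid S = \<lparr>carrier = lists S, mult = (@), one = []\<rparr>"

text \<open>The exterior algebra of a \<open>K\<close>-module \<open>M\<close>: the free associative \<open>K\<close>-algebra on the set \<open>M\<close>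
  modulo the relations making the map sending \<open>v\<close> to its generator \<open>K\<close>-linear (which yields the tensor algebra)
  and modulo \<open>v \<and> v = 0\<close>.\<close>

definition exterior_relations ::
    "('k, 'm) ring_scheme \<Rightarrow> ('k, 'b, 'n) module_scheme \<Rightarrow> ('b list \<Rightarrow> 'k) set"
  where "exterior_relations K M =
    (let T = monoid_algebra K (word_monoid (carrier M)); g = (\<lambda>v. basis_elt K [v]) in
      {g (v \<oplus>\<^bsub>M\<^esub> w) \<ominus>\<^bsub>T\<^esub> (g v \<oplus>\<^bsub>T\<^esub> g w) | v w. v \<in> carrier M \<and> w \<in> carrier M} \<union>
      {g (c \<odot>\<^bsub>M\<^esub> v) \<ominus>\<^bsub>T\<^esub> (c \<odot>\<^bsub>T\<^esub> g v) | c v. c \<in> carrier K \<and> v \<in> carrier M} \<union>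
      {g v \<otimes>\<^bsub>T\<^esub> g v | v. v \<in> carrier M})"

definition exterior_algebra ::
    "('k, 'm) ring_scheme \<Rightarrow> ('k, 'b, 'n) module_scheme \<Rightarrow> ('k, ('b list \<Rightarrow> 'k) set) module"
  where "exterior_algebra K M =
    (let T = monoid_algebra K (word_monoid (carrier M)) in
      quotient_algebra T (Idl\<^bsub>T\<^esub> (exterior_relations K M)))"

text \<open>The free module \<open>K\<^sup>n\<close>; the fields \<open>mult\<close> and \<open>one\<close> of the module record play no role.\<close>

definition free_module :: "('k, 'm) ring_scheme \<Rightarrow> nat \<Rightarrow> ('k, nat \<Rightarrow> 'k) module"
  where "free_module K n =
    \<lparr>carrier = {1..n} \<rightarrow>\<^sub>E carrier K,
     mult = (\<lambda>v w. \<lambda>i\<in>{1..n}. v i \<otimes>\<^bsub>K\<^esub> w i),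
     one = (\<lambda>i\<in>{1..n}. \<one>\<^bsub>K\<^esub>),
     zero = (\<lambda>i\<in>{1..n}. \<zero>\<^bsub>K\<^esub>),
     add = (\<lambda>v w. \<lambda>i\<in>{1..n}. v i \<oplus>\<^bsub>K\<^esub> w i),
     smult = (\<lambda>c v. \<lambda>i\<in>{1..n}. c \<otimes>\<^bsub>K\<^esub> v i)\<rparr>"


section \<open>The tensor product of two algebras\<close>

text \<open>The ring \<open>A \<otimes>\<^sub>K B\<close> as a quotient of the integral monoid ring on the pairs \<open>(a, b)\<close>. The additive
  group of that ring is free abelian on the pairs, its multiplication extends
  \<open>(a, b) (a', b') = (a a', b b')\<close>, and the additive subgroup generated by the usual balancing
  relations is already a two-sided ideal when \<open>A\<close> and \<open>B\<close> are \<open>K\<close>-algebras.\<close>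

definition tensor_relations ::
    "('k, 'm) ring_scheme \<Rightarrow> ('k, 'a, 'p) module_scheme \<Rightarrow> ('k, 'b, 'q) module_scheme
      \<Rightarrow> ('a \<times> 'b \<Rightarrow> int) set"
  where "tensor_relations K A B =
    (let T = monoid_algebra \<Z> (A \<times>\<times> B); g = (\<lambda>a b. basis_elt \<Z> (a, b)) in
      {g (a \<oplus>\<^bsub>A\<^esub> a') b \<ominus>\<^bsub>T\<^esub> (g a b \<oplus>\<^bsub>T\<^esub> g a' b) | a a' b.
          a \<in> carrier A \<and> a' \<in> carrier A \<and> b \<in> carrier B} \<union>
      {g a (b \<oplus>\<^bsub>B\<^esub> b') \<ominus>\<^bsub>T\<^esub> (g a b \<oplus>\<^bsub>T\<^esub> g a b') | a b b'.
          a \<in> carrier A \<and> b \<in> carrier B \<and> b' \<in> carrier B} \<union>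
      {g (c \<odot>\<^bsub>A\<^esub> a) b \<ominus>\<^bsub>T\<^esub> g a (c \<odot>\<^bsub>B\<^esub> b) | c a b.
          c \<in> carrier K \<and> a \<in> carrier A \<and> b \<in> carrier B})"

definition tensor_ring ::
    "('k, 'm) ring_scheme \<Rightarrow> ('k, 'a, 'p) module_scheme \<Rightarrow> ('k, 'b, 'q) module_scheme
      \<Rightarrow> ('a \<times> 'b \<Rightarrow> int) set ring"
  where "tensor_ring K A B =
    (let T = monoid_algebra \<Z> (A \<times>\<times> B) in T Quot (Idl\<^bsub>T\<^esub> (tensor_relations K A B)))"


section \<open>The exterior algebra of a free module over a not necessarily commutative ring\<close>

definition exterior_ring ::
    "('a, 'm) ring_scheme \<Rightarrow> nat \<Rightarrow>
      ('a \<times> ((nat \<Rightarrow> 'a) list \<Rightarrow> 'a) set \<Rightarrow> int) set ring"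
  where "exterior_ring A n =
    (let C = center_ring A in
      tensor_ring C (center_module A) (exterior_algebra C (free_module C n)))"

end

theory Submission
  imports Defs "HOL-Algebra.Subrings"
begin

text \<open>Central essentiality is a statement about which elements vanish, and the defining presentation
of \<open>\<Lambda>(A\<^sup>n)\<close>, a quotient of a monoid ring built on a quotient of a free algebra, does not
show that. The proof therefore passes to the standard basis \<open>e\<^sub>S\<close>, \<open>S \<subseteq> {1..n}\<close>: an element is a
function \<open>f\<close> from subsets to \<open>A\<close>, standing for \<open>\<Sum> f(S) e\<^sub>S\<close>, and \<open>e\<^sub>U e\<^sub>V\<close> is \<open>\<plusminus>e\<^sub>W\<close> with
\<open>W = U \<union> V\<close> for disjoint \<open>U\<close>, \<open>V\<close> and \<open>0\<close> otherwise. This ring is a monoid algebra of the semilattice of subsets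
whose product is twisted by a sign; its associativity is the cocycle identity for the sign, that
is, additivity of the number of inversions.

In this ring \<open>e\<^sub>i e\<^sub>S = (-1)\<^bsup>|S|\<^esup> e\<^sub>S e\<^sub>i\<close> for \<open>i \<notin> S\<close>. Hence \<open>f\<close> is central if and only if all
\<open>f(S)\<close> are central in \<open>A\<close> and \<open>2 f(S) = 0\<close> whenever \<open>|S|\<close> is odd and \<open>S\<close> is not the whole index
set \<open>T = {1..n}\<close> (\<open>central_iff\<close>). The exception for \<open>T\<close>, whose size is odd exactly for odd \<open>n\<close>, is
where the parity of \<open>n\<close> enters.

\<^item> If the exterior algebra is centrally essential, then testing it on \<open>a e\<^sub>T\<close> gives
  \<open>c \<in> C\<close> with \<open>0 \<noteq> a c \<in> C\<close>, since multiplication sees only the constant coefficient of the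
  multiplier. For even \<open>n\<close>, testing it on \<open>a e\<^sub>U\<close> with \<open>U = {1..n-1}\<close>, which has odd degree,
  gives a nonzero multiple of \<open>a\<close> killed by \<open>2\<close>.
\<^item> Conversely, an element of \<open>C\<close> brings all coefficients of a nonzero \<open>f\<close> into \<open>C\<close>, one after
  another, without making \<open>f\<close> vanish (\<open>scale_coefficients_into\<close>). If \<open>Ann(2)\<close> is essential,
  the same argument brings them into \<open>Ann(2)\<close>, and \<open>f\<close> has become central. If \<open>n\<close> is odd and \<open>f\<close> is
  not central, take \<open>S\<close> of least odd size with \<open>f(S) \<noteq> 0\<close>. Its complement \<open>V\<close> has even size, so
  \<open>e\<^sub>V\<close> is central, and the only term of odd degree that survives in \<open>f e\<^sub>V\<close> is \<open>\<plusminus>f(S) e\<^sub>T\<close>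
  (\<open>central_multiple_of_central_coefficients\<close>).

It remains to identify the two rings. The universal property of monoid algebras
(\<open>monoid_algebra_map\<close>) maps both presentations to the ring on the standard basis, and the relations
go to \<open>0\<close>. Nothing else does: anticommutation sorts every word in the generators
(\<open>insert_into_increasing\<close>), so every class in the tensor product is some \<open>\<Sum> a\<^sub>S \<otimes> e\<^sub>S\<close>, and
it can be recovered from its image, whose coefficients are the \<open>a\<^sub>S\<close> (\<open>section_\<psi>\<close>).\<close>

section \<open>Twisted monoid algebras\<close>

text \<open>The common generalization of the monoid algebras in the presentation (trivial \<open>\<sigma>\<close>) and of the
exterior algebra on its standard basis (\<open>\<sigma> U V\<close> multiplies by \<open>1\<close>, \<open>-1\<close> or \<open>0\<close>), so that the ring
axioms need to be checked only once. The twist is an additive map rather than a scalar, so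
that for trivial \<open>\<sigma>\<close> the definition coincides literally with that of the monoid algebra.\<close>

definition twisted_algebra ::
    "('k, 'm) ring_scheme \<Rightarrow> ('w, 'n) monoid_scheme \<Rightarrow> ('w \<Rightarrow> 'w \<Rightarrow> 'k \<Rightarrow> 'k) \<Rightarrow> ('k, 'w \<Rightarrow> 'k) module"
  where "twisted_algebra K M \<sigma> =
    \<lparr>carrier = {f. (\<forall>w. f w \<in> carrier K) \<and> (\<forall>w. w \<notin> carrier M \<longrightarrow> f w = \<zero>\<^bsub>K\<^esub>) \<and>
                   finite {w. f w \<noteq> \<zero>\<^bsub>K\<^esub>}},
     mult = (\<lambda>f g w. \<Oplus>\<^bsub>K\<^esub>p \<in> {p. f (fst p) \<noteq> \<zero>\<^bsub>K\<^esub> \<and> g (snd p) \<noteq> \<zero>\<^bsub>K\<^esub> \<and> fst p \<otimes>\<^bsub>M\<^esub> snd p = w}.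
                      \<sigma> (fst p) (snd p) (f (fst p) \<otimes>\<^bsub>K\<^esub> g (snd p))),
     one = (\<lambda>w. if w = \<one>\<^bsub>M\<^esub> then \<one>\<^bsub>K\<^esub> else \<zero>\<^bsub>K\<^esub>),
     zero = (\<lambda>w. \<zero>\<^bsub>K\<^esub>),
     add = (\<lambda>f g w. f w \<oplus>\<^bsub>K\<^esub> g w),
     smult = (\<lambda>c f w. c \<otimes>\<^bsub>K\<^esub> f w)\<rparr>"

lemma carrier_twisted_algebra: "carrier (twisted_algebra K M \<sigma>) =
    {f. (\<forall>w. f w \<in> carrier K) \<and> (\<forall>w. w \<notin> carrier M \<longrightarrow> f w = \<zero>\<^bsub>K\<^esub>) \<and> finite {w. f w \<noteq> \<zero>\<^bsub>K\<^esub>}}"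
  by (simp add: twisted_algebra_def)

lemma monoid_algebra_eq_twisted: "monoid_algebra K M = twisted_algebra K M (\<lambda>_ _ x. x)"
  by (simp add: monoid_algebra_def twisted_algebra_def)

definition monomial :: "('k, 'm) ring_scheme \<Rightarrow> 'k \<Rightarrow> 'w \<Rightarrow> 'w \<Rightarrow> 'k"
  where "monomial K k w = (\<lambda>v. if v = w then k else \<zero>\<^bsub>K\<^esub>)"

lemma monomial_apply [simp]: "monomial K k w w = k"
  by (simp add: monomial_def)

lemma monomial_apply_neq: "v \<noteq> w \<Longrightarrow> monomial K k w v = \<zero>\<^bsub>K\<^esub>"
  by (simp add: monomial_def)

lemma basis_elt_eq_monomial: "basis_elt K w = monomial K \<one>\<^bsub>K\<^esub> w"
  by (simp add: basis_elt_def monomial_def)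

locale twisted = K: ring K + M: monoid M
  for K :: "('k, 'm) ring_scheme" (structure) and M :: "('w, 'n) monoid_scheme" (structure) +
  fixes \<sigma> :: "'w \<Rightarrow> 'w \<Rightarrow> 'k \<Rightarrow> 'k"
  assumes tw_closed: "\<lbrakk>u \<in> carrier M; v \<in> carrier M; a \<in> carrier K\<rbrakk> \<Longrightarrow> \<sigma> u v a \<in> carrier K"
    and tw_add: "\<lbrakk>u \<in> carrier M; v \<in> carrier M; a \<in> carrier K; b \<in> carrier K\<rbrakk> \<Longrightarrow>
          \<sigma> u v (a \<oplus>\<^bsub>K\<^esub> b) = \<sigma> u v a \<oplus>\<^bsub>K\<^esub> \<sigma> u v b"
    and tw_mult_left: "\<lbrakk>u \<in> carrier M; v \<in> carrier M; a \<in> carrier K; b \<in> carrier K\<rbrakk> \<Longrightarrow>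
          \<sigma> u v a \<otimes>\<^bsub>K\<^esub> b = \<sigma> u v (a \<otimes>\<^bsub>K\<^esub> b)"
    and tw_mult_right: "\<lbrakk>u \<in> carrier M; v \<in> carrier M; a \<in> carrier K; b \<in> carrier K\<rbrakk> \<Longrightarrow>
          a \<otimes>\<^bsub>K\<^esub> \<sigma> u v b = \<sigma> u v (a \<otimes>\<^bsub>K\<^esub> b)"
    and tw_one_left: "\<lbrakk>u \<in> carrier M; a \<in> carrier K\<rbrakk> \<Longrightarrow> \<sigma> \<one>\<^bsub>M\<^esub> u a = a"
    and tw_one_right: "\<lbrakk>u \<in> carrier M; a \<in> carrier K\<rbrakk> \<Longrightarrow> \<sigma> u \<one>\<^bsub>M\<^esub> a = a"
    and tw_cocycle: "\<lbrakk>u \<in> carrier M; v \<in> carrier M; w \<in> carrier M; a \<in> carrier K\<rbrakk> \<Longrightarrow>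
          \<sigma> (u \<otimes>\<^bsub>M\<^esub> v) w (\<sigma> u v a) = \<sigma> u (v \<otimes>\<^bsub>M\<^esub> w) (\<sigma> v w a)"
begin

abbreviation T where "T \<equiv> twisted_algebra K M \<sigma>"

lemma tw_zero:
  assumes "u \<in> carrier M" "v \<in> carrier M"
  shows "\<sigma> u v \<zero>\<^bsub>K\<^esub> = \<zero>\<^bsub>K\<^esub>"
  using tw_add[OF assms K.zero_closed K.zero_closed] tw_closed[OF assms K.zero_closed] by simp

lemma carrierI:
  assumes "\<And>w. f w \<in> carrier K" "\<And>w. w \<notin> carrier M \<Longrightarrow> f w = \<zero>\<^bsub>K\<^esub>" "finite {w. f w \<noteq> \<zero>\<^bsub>K\<^esub>}"
  shows "f \<in> carrier T"
  using assms unfolding carrier_twisted_algebra by blast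

lemma carrier_coeff: "f \<in> carrier T \<Longrightarrow> f w \<in> carrier K"
  and carrier_outside: "f \<in> carrier T \<Longrightarrow> w \<notin> carrier M \<Longrightarrow> f w = \<zero>\<^bsub>K\<^esub>"
  and carrier_finite: "f \<in> carrier T \<Longrightarrow> finite {w. f w \<noteq> \<zero>\<^bsub>K\<^esub>}"
  unfolding carrier_twisted_algebra by blast+

lemma add_apply: "(f \<oplus>\<^bsub>T\<^esub> g) w = f w \<oplus>\<^bsub>K\<^esub> g w"
  and zero_apply: "\<zero>\<^bsub>T\<^esub> w = \<zero>\<^bsub>K\<^esub>"
  by (simp_all add: twisted_algebra_def)

lemma one_eq_monomial: "\<one>\<^bsub>T\<^esub> = monomial K \<one>\<^bsub>K\<^esub> \<one>\<^bsub>M\<^esub>"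
  and zero_eq: "\<zero>\<^bsub>T\<^esub> = (\<lambda>w. \<zero>\<^bsub>K\<^esub>)"
  by (simp_all add: twisted_algebra_def monomial_def)

lemma monomial_zero: "monomial K \<zero>\<^bsub>K\<^esub> w = \<zero>\<^bsub>T\<^esub>"
  by (auto simp: zero_apply monomial_def)

lemma monomial_closed [simp]: "\<lbrakk>k \<in> carrier K; w \<in> carrier M\<rbrakk> \<Longrightarrow> monomial K k w \<in> carrier T"
  by (rule carrierI) (auto simp: monomial_def)

lemma monomial_add: "\<lbrakk>k \<in> carrier K; l \<in> carrier K\<rbrakk> \<Longrightarrow> monomial K (k \<oplus>\<^bsub>K\<^esub> l) w = monomial K k w \<oplus>\<^bsub>T\<^esub> monomial K l w"
  by (auto simp: monomial_def add_apply)

lemma smult_monomial: "\<lbrakk>c \<in> carrier K; k \<in> carrier K\<rbrakk> \<Longrightarrow> c \<odot>\<^bsub>T\<^esub> monomial K k w = monomial K (c \<otimes>\<^bsub>K\<^esub> k) w"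
  by (auto simp: monomial_def twisted_algebra_def)

lemma add_carrier:
  assumes "f \<in> carrier T" "g \<in> carrier T"
  shows "f \<oplus>\<^bsub>T\<^esub> g \<in> carrier T"
proof (rule carrierI)
  have "{w. (f \<oplus>\<^bsub>T\<^esub> g) w \<noteq> \<zero>\<^bsub>K\<^esub>} \<subseteq> {w. f w \<noteq> \<zero>\<^bsub>K\<^esub>} \<union> {w. g w \<noteq> \<zero>\<^bsub>K\<^esub>}"
    by (auto simp: add_apply)
  then show "finite {w. (f \<oplus>\<^bsub>T\<^esub> g) w \<noteq> \<zero>\<^bsub>K\<^esub>}"
    using assms carrier_finite by (metis (no_types, lifting) finite_UnI finite_subset)
qed (use assms in \<open>auto simp: add_apply carrier_outside carrier_coeff[OF assms(1)] carrier_coeff[OF assms(2)]\<close>)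

lemma abelian_group_twisted: "abelian_group T"
proof (rule abelian_groupI)
  fix f assume f: "f \<in> carrier T"
  note coeff = carrier_coeff[OF f]
  have "(\<lambda>w. \<ominus>\<^bsub>K\<^esub> f w) \<in> carrier T"
  proof (rule carrierI)
    have "{w. \<ominus>\<^bsub>K\<^esub> f w \<noteq> \<zero>\<^bsub>K\<^esub>} \<subseteq> {w. f w \<noteq> \<zero>\<^bsub>K\<^esub>}"
      by auto
    then show "finite {w. \<ominus>\<^bsub>K\<^esub> f w \<noteq> \<zero>\<^bsub>K\<^esub>}"
      using f carrier_finite finite_subset by blast
  qed (use f in \<open>auto simp: carrier_outside coeff\<close>)
  moreover have "(\<lambda>w. \<ominus>\<^bsub>K\<^esub> f w) \<oplus>\<^bsub>T\<^esub> f = \<zero>\<^bsub>T\<^esub>"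
    using f by (auto simp: K.l_neg coeff add_apply zero_apply)
  ultimately show "\<exists>g\<in>carrier T. g \<oplus>\<^bsub>T\<^esub> f = \<zero>\<^bsub>T\<^esub>" by blast
qed (auto simp: add_carrier K.a_ac fun_eq_iff add_apply zero_apply carrier_coeff intro!: carrierI)

sublocale T: abelian_group T
  by (rule abelian_group_twisted)

text \<open>The monomials in the second case are those that occur in \<open>f\<close> itself. Restrictions on the support
or on the coefficients of \<open>f\<close> are thus available there, while multiplicative identities, being
additive in each argument, reduce to monomials.\<close>

lemma monomial_induct [consumes 1, case_names zero mono add]:
  assumes f: "f \<in> carrier T"
    and zero: "P \<zero>\<^bsub>T\<^esub>"
    and mono: "\<And>w. \<lbrakk>w \<in> carrier M; f w \<noteq> \<zero>\<^bsub>K\<^esub>\<rbrakk> \<Longrightarrow> P (monomial K (f w) w)"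
    and add: "\<And>g h. \<lbrakk>g \<in> carrier T; h \<in> carrier T; P g; P h\<rbrakk> \<Longrightarrow> P (g \<oplus>\<^bsub>T\<^esub> h)"
  shows "P f"
proof -
  note coeff = carrier_coeff[OF f]
  let ?r = "\<lambda>X. (\<lambda>w. if w \<in> X then f w else \<zero>\<^bsub>K\<^esub>)"
  have r: "?r X \<in> carrier T" for X
  proof (rule carrierI)
    show "finite {w. ?r X w \<noteq> \<zero>\<^bsub>K\<^esub>}"
      by (rule finite_subset[OF _ carrier_finite[OF f]]) auto
  qed (use f in \<open>auto simp: carrier_outside coeff\<close>)
  have "P (?r X)" if "finite X" "X \<subseteq> {w. f w \<noteq> \<zero>\<^bsub>K\<^esub>}" for X
    using that
  proof (induction X)
    case empty
    then show ?case using zero by (simp add: zero_eq)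
  next
    case (insert x X)
    have x: "x \<in> carrier M" using insert.prems f carrier_outside by blast
    have "?r (insert x X) = monomial K (f x) x \<oplus>\<^bsub>T\<^esub> ?r X"
      using insert.hyps f by (auto simp: monomial_def fun_eq_iff coeff add_apply)
    moreover have "P (monomial K (f x) x \<oplus>\<^bsub>T\<^esub> ?r X)"
      using insert x f r by (intro add) (auto intro: mono simp: coeff)
    ultimately show ?case by (simp only:)
  qed
  from this[OF carrier_finite[OF f]] have "P (?r {w. f w \<noteq> \<zero>\<^bsub>K\<^esub>})" by simp
  moreover have "?r {w. f w \<noteq> \<zero>\<^bsub>K\<^esub>} = f" by auto
  ultimately show ?thesis by simp
qed

text \<open>The sum that defines the product runs over a set that depends on the supports of both factors.
Extending it to any larger finite rectangle makes products with different factors comparable,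
as distributivity requires.\<close>

lemma mult_superset:
  assumes f: "f \<in> carrier T" and g: "g \<in> carrier T"
    and F: "finite F" "{w. f w \<noteq> \<zero>\<^bsub>K\<^esub>} \<subseteq> F" "F \<subseteq> carrier M"
    and G: "finite G" "{w. g w \<noteq> \<zero>\<^bsub>K\<^esub>} \<subseteq> G" "G \<subseteq> carrier M"
  shows "(f \<otimes>\<^bsub>T\<^esub> g) w =
    (\<Oplus>\<^bsub>K\<^esub>p\<in>F \<times> G. if fst p \<otimes>\<^bsub>M\<^esub> snd p = w then \<sigma> (fst p) (snd p) (f (fst p) \<otimes>\<^bsub>K\<^esub> g (snd p)) else \<zero>\<^bsub>K\<^esub>)"
proof -
  note coeff = carrier_coeff[OF f] carrier_coeff[OF g]
  have "(f \<otimes>\<^bsub>T\<^esub> g) w = (\<Oplus>\<^bsub>K\<^esub>p \<in> {p. f (fst p) \<noteq> \<zero>\<^bsub>K\<^esub> \<and> g (snd p) \<noteq> \<zero>\<^bsub>K\<^esub> \<and> fst p \<otimes>\<^bsub>M\<^esub> snd p = w}.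
                      \<sigma> (fst p) (snd p) (f (fst p) \<otimes>\<^bsub>K\<^esub> g (snd p)))"
    by (simp add: twisted_algebra_def)
  also have "\<dots> = (\<Oplus>\<^bsub>K\<^esub>p\<in>F \<times> G. if fst p \<otimes>\<^bsub>M\<^esub> snd p = w
                then \<sigma> (fst p) (snd p) (f (fst p) \<otimes>\<^bsub>K\<^esub> g (snd p)) else \<zero>\<^bsub>K\<^esub>)"
  proof (rule K.add.finprod_mono_neutral_cong_left)
    fix p
    assume p: "p \<in> F \<times> G - {p. f (fst p) \<noteq> \<zero>\<^bsub>K\<^esub> \<and> g (snd p) \<noteq> \<zero>\<^bsub>K\<^esub> \<and> fst p \<otimes>\<^bsub>M\<^esub> snd p = w}"
    then have "fst p \<in> carrier M" "snd p \<in> carrier M" using F G by auto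
    then show "(if fst p \<otimes>\<^bsub>M\<^esub> snd p = w then \<sigma> (fst p) (snd p) (f (fst p) \<otimes>\<^bsub>K\<^esub> g (snd p)) else \<zero>\<^bsub>K\<^esub>) = \<zero>\<^bsub>K\<^esub>"
      using p f g by (auto simp: tw_zero coeff)
  next
    show "(\<lambda>p. if fst p \<otimes>\<^bsub>M\<^esub> snd p = w then \<sigma> (fst p) (snd p) (f (fst p) \<otimes>\<^bsub>K\<^esub> g (snd p)) else \<zero>\<^bsub>K\<^esub>)
      \<in> F \<times> G \<rightarrow> carrier K"
      using f g F G by (auto intro!: tw_closed simp: coeff)
  qed (use F G in auto)
  finally show ?thesis .
qed

lemma mult_closed:
  assumes f: "f \<in> carrier T" and g: "g \<in> carrier T"
  shows "f \<otimes>\<^bsub>T\<^esub> g \<in> carrier T"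
proof (rule carrierI)
  let ?F = "{w. f w \<noteq> \<zero>\<^bsub>K\<^esub>}" and ?G = "{w. g w \<noteq> \<zero>\<^bsub>K\<^esub>}"
  have sub: "?F \<subseteq> carrier M" "?G \<subseteq> carrier M"
    using f g carrier_outside by auto
  note sup = mult_superset[OF f g carrier_finite[OF f] order_refl sub(1) carrier_finite[OF g] order_refl sub(2)]
  show "(f \<otimes>\<^bsub>T\<^esub> g) w \<in> carrier K" for w
    unfolding sup using carrier_coeff[OF f] carrier_coeff[OF g] sub by (intro K.finsum_closed) (auto intro!: tw_closed)
  have zero: "(f \<otimes>\<^bsub>T\<^esub> g) w = \<zero>\<^bsub>K\<^esub>" if "w \<notin> (\<lambda>p. fst p \<otimes>\<^bsub>M\<^esub> snd p) ` (?F \<times> ?G)" for w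
    unfolding sup using that by (intro K.add.finprod_one_eqI) auto
  show "(f \<otimes>\<^bsub>T\<^esub> g) w = \<zero>\<^bsub>K\<^esub>" if "w \<notin> carrier M" for w
    using that sub by (intro zero) (use M.m_closed in \<open>force\<close>)
  show "finite {w. (f \<otimes>\<^bsub>T\<^esub> g) w \<noteq> \<zero>\<^bsub>K\<^esub>}"
    by (rule finite_subset[of _ "(\<lambda>p. fst p \<otimes>\<^bsub>M\<^esub> snd p) ` (?F \<times> ?G)"])
      (use zero carrier_finite f g in auto)
qed

lemma monomial_mult_monomial:
  assumes "a \<in> carrier K" "b \<in> carrier K" "u \<in> carrier M" "v \<in> carrier M"
  shows "monomial K a u \<otimes>\<^bsub>T\<^esub> monomial K b v = monomial K (\<sigma> u v (a \<otimes>\<^bsub>K\<^esub> b)) (u \<otimes>\<^bsub>M\<^esub> v)"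
proof
  fix w
  have "(monomial K a u \<otimes>\<^bsub>T\<^esub> monomial K b v) w =
    (\<Oplus>\<^bsub>K\<^esub>p\<in>{u} \<times> {v}. if fst p \<otimes>\<^bsub>M\<^esub> snd p = w
        then \<sigma> (fst p) (snd p) (monomial K a u (fst p) \<otimes>\<^bsub>K\<^esub> monomial K b v (snd p)) else \<zero>\<^bsub>K\<^esub>)"
    using assms by (intro mult_superset monomial_closed) (auto simp: monomial_def split: if_splits)
  also have "\<dots> = monomial K (\<sigma> u v (a \<otimes>\<^bsub>K\<^esub> b)) (u \<otimes>\<^bsub>M\<^esub> v) w"
    using assms tw_closed by (simp add: monomial_def)
  finally show "(monomial K a u \<otimes>\<^bsub>T\<^esub> monomial K b v) w = monomial K (\<sigma> u v (a \<otimes>\<^bsub>K\<^esub> b)) (u \<otimes>\<^bsub>M\<^esub> v) w" .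
qed

lemma mult_add_distrib:
  assumes f: "f \<in> carrier T" and g: "g \<in> carrier T" and h: "h \<in> carrier T"
  shows "(f \<oplus>\<^bsub>T\<^esub> g) \<otimes>\<^bsub>T\<^esub> h = f \<otimes>\<^bsub>T\<^esub> h \<oplus>\<^bsub>T\<^esub> g \<otimes>\<^bsub>T\<^esub> h"
    and "h \<otimes>\<^bsub>T\<^esub> (f \<oplus>\<^bsub>T\<^esub> g) = h \<otimes>\<^bsub>T\<^esub> f \<oplus>\<^bsub>T\<^esub> h \<otimes>\<^bsub>T\<^esub> g"
proof -
  let ?F = "{w. f w \<noteq> \<zero>\<^bsub>K\<^esub>} \<union> {w. g w \<noteq> \<zero>\<^bsub>K\<^esub>}" and ?H = "{w. h w \<noteq> \<zero>\<^bsub>K\<^esub>}"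
  note coeff = carrier_coeff[OF f] carrier_coeff[OF g] carrier_coeff[OF h]
  have fg: "f \<oplus>\<^bsub>T\<^esub> g \<in> carrier T" using f g by (rule add_carrier)
  have F: "finite ?F" "?F \<subseteq> carrier M" using f g carrier_finite carrier_outside by auto
  have H: "finite ?H" "?H \<subseteq> carrier M" using h carrier_finite carrier_outside by auto
  have sub: "{w. f w \<noteq> \<zero>\<^bsub>K\<^esub>} \<subseteq> ?F" "{w. g w \<noteq> \<zero>\<^bsub>K\<^esub>} \<subseteq> ?F" "{w. (f \<oplus>\<^bsub>T\<^esub> g) w \<noteq> \<zero>\<^bsub>K\<^esub>} \<subseteq> ?F"
    by (auto simp: add_apply)
  note L = mult_superset[OF _ h F(1) _ F(2) H(1) order_refl H(2)]
  note R = mult_superset[OF h _ H(1) order_refl H(2) F(1) _ F(2)]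
  show "(f \<oplus>\<^bsub>T\<^esub> g) \<otimes>\<^bsub>T\<^esub> h = f \<otimes>\<^bsub>T\<^esub> h \<oplus>\<^bsub>T\<^esub> g \<otimes>\<^bsub>T\<^esub> h"
  proof
    fix w
    show "((f \<oplus>\<^bsub>T\<^esub> g) \<otimes>\<^bsub>T\<^esub> h) w = (f \<otimes>\<^bsub>T\<^esub> h \<oplus>\<^bsub>T\<^esub> g \<otimes>\<^bsub>T\<^esub> h) w"
      unfolding add_apply L[OF f sub(1)] L[OF g sub(2)] L[OF fg sub(3)]
      using f g h F H
      by (subst K.finsum_addf[symmetric])
        (auto intro!: tw_closed K.finsum_cong' simp: K.l_distr tw_add[symmetric] subset_iff coeff)
  qed
  show "h \<otimes>\<^bsub>T\<^esub> (f \<oplus>\<^bsub>T\<^esub> g) = h \<otimes>\<^bsub>T\<^esub> f \<oplus>\<^bsub>T\<^esub> h \<otimes>\<^bsub>T\<^esub> g"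
  proof
    fix w
    show "(h \<otimes>\<^bsub>T\<^esub> (f \<oplus>\<^bsub>T\<^esub> g)) w = (h \<otimes>\<^bsub>T\<^esub> f \<oplus>\<^bsub>T\<^esub> h \<otimes>\<^bsub>T\<^esub> g) w"
      unfolding add_apply R[OF f sub(1)] R[OF g sub(2)] R[OF fg sub(3)]
      using f g h F H
      by (subst K.finsum_addf[symmetric])
        (auto intro!: tw_closed K.finsum_cong' simp: K.r_distr tw_add[symmetric] subset_iff coeff)
  qed
qed

lemma mult_zero:
  assumes "f \<in> carrier T"
  shows "f \<otimes>\<^bsub>T\<^esub> \<zero>\<^bsub>T\<^esub> = \<zero>\<^bsub>T\<^esub>" "\<zero>\<^bsub>T\<^esub> \<otimes>\<^bsub>T\<^esub> f = \<zero>\<^bsub>T\<^esub>"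
  using mult_add_distrib[OF T.zero_closed T.zero_closed assms] mult_closed[OF assms T.zero_closed]
    mult_closed[OF T.zero_closed assms] by (auto simp: T.add.l_cancel_one)

text \<open>Both sides are additive in each factor, and on monomials associativity is the cocycle identity.\<close>

lemma mult_assoc:
  assumes f: "f \<in> carrier T" and g: "g \<in> carrier T" and h: "h \<in> carrier T"
  shows "(f \<otimes>\<^bsub>T\<^esub> g) \<otimes>\<^bsub>T\<^esub> h = f \<otimes>\<^bsub>T\<^esub> (g \<otimes>\<^bsub>T\<^esub> h)"
  using f
proof (induction f rule: monomial_induct)
  case zero
  then show ?case by (simp add: mult_zero mult_closed g h)
next
  case add
  then show ?case by (simp add: mult_add_distrib mult_closed g h)
next
  case (mono u)
  note u = mono(1) and coeff = carrier_coeff[OF f] carrier_coeff[OF g] carrier_coeff[OF h]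
  have m: "monomial K (f u) u \<in> carrier T" using coeff u by simp
  show ?case
    using g
  proof (induction g rule: monomial_induct)
    case zero
    then show ?case by (simp add: mult_zero m h)
  next
    case add
    then show ?case by (simp add: mult_add_distrib mult_closed m h)
  next
    case (mono v)
    note v = mono(1)
    have m': "monomial K (g v) v \<in> carrier T" using coeff v by simp
    show ?case
      using h
    proof (induction h rule: monomial_induct)
      case zero
      then show ?case by (simp add: mult_zero mult_closed m m')
    next
      case add
      then show ?case by (simp add: mult_add_distrib mult_closed m m')
    next
      case (mono w)
      then show ?case
        using coeff u v
        by (simp add: monomial_mult_monomial tw_closed tw_mult_left tw_mult_right K.m_assoc M.m_assoc tw_cocycle)
    qed
  qed
qed

lemma mult_one:
  assumes "f \<in> carrier T"
  shows "\<one>\<^bsub>T\<^esub> \<otimes>\<^bsub>T\<^esub> f = f" "f \<otimes>\<^bsub>T\<^esub> \<one>\<^bsub>T\<^esub> = f"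
proof -
  have one: "\<one>\<^bsub>T\<^esub> \<in> carrier T" by (simp add: one_eq_monomial)
  show "\<one>\<^bsub>T\<^esub> \<otimes>\<^bsub>T\<^esub> f = f"
    using assms
  proof (induction f rule: monomial_induct)
    case (mono w)
    then show ?case using carrier_coeff[OF assms] by (simp add: one_eq_monomial monomial_mult_monomial tw_one_left)
  qed (simp_all add: one mult_zero mult_add_distrib)
  show "f \<otimes>\<^bsub>T\<^esub> \<one>\<^bsub>T\<^esub> = f"
    using assms
  proof (induction f rule: monomial_induct)
    case (mono w)
    then show ?case using carrier_coeff[OF assms] by (simp add: one_eq_monomial monomial_mult_monomial tw_one_right)
  qed (simp_all add: one mult_zero mult_add_distrib)
qed

lemma ring_twisted: "ring T"
proof (rule ringI)
  show "monoid T"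
    by (rule monoidI) (auto simp: mult_closed mult_assoc mult_one, simp add: one_eq_monomial)
qed (auto simp: T.abelian_group_axioms mult_add_distrib)

sublocale T: ring T
  by (rule ring_twisted)

end

section \<open>The universal property of monoid algebras\<close>

lemma twisted_trivial:
  assumes "ring K" "monoid M"
  shows "twisted K M (\<lambda>_ _ x. x)"
  using assms by (simp add: twisted_def twisted_axioms_def)

definition linear_extension ::
    "('k, 'm) ring_scheme \<Rightarrow> ('s, 'p) ring_scheme \<Rightarrow> ('k \<Rightarrow> 's) \<Rightarrow> ('w \<Rightarrow> 's) \<Rightarrow> ('w \<Rightarrow> 'k) \<Rightarrow> 's"
  where "linear_extension K S \<rho> \<mu> f = (\<Oplus>\<^bsub>S\<^esub>w\<in>{w. f w \<noteq> \<zero>\<^bsub>K\<^esub>}. \<rho> (f w) \<otimes>\<^bsub>S\<^esub> \<mu> w)"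

text \<open>The universal property: maps \<open>\<rho>\<close> on scalars and \<open>\<mu>\<close> on the monoid extend to a ring
homomorphism (\<open>extend_hom\<close>). In a monoid algebra, scalars commute
with the monoid elements, which is why \<open>\<rho>\<close> has to commute with \<open>\<mu>\<close> in the possibly noncommutative target.\<close>

locale monoid_algebra_map = K: ring K + M: monoid M + S: ring S
  for K :: "('k, 'm) ring_scheme" and M :: "('w, 'n) monoid_scheme" and S :: "('s, 'p) ring_scheme" +
  fixes \<rho> :: "'k \<Rightarrow> 's" and \<mu> :: "'w \<Rightarrow> 's"
  assumes scalars: "\<rho> \<in> ring_hom K S"
    and monoid_closed: "w \<in> carrier M \<Longrightarrow> \<mu> w \<in> carrier S"
    and monoid_mult: "\<lbrakk>u \<in> carrier M; v \<in> carrier M\<rbrakk> \<Longrightarrow> \<mu> (u \<otimes>\<^bsub>M\<^esub> v) = \<mu> u \<otimes>\<^bsub>S\<^esub> \<mu> v"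
    and monoid_one: "\<mu> \<one>\<^bsub>M\<^esub> = \<one>\<^bsub>S\<^esub>"
    and commute: "\<lbrakk>k \<in> carrier K; w \<in> carrier M\<rbrakk> \<Longrightarrow> \<rho> k \<otimes>\<^bsub>S\<^esub> \<mu> w = \<mu> w \<otimes>\<^bsub>S\<^esub> \<rho> k"
begin

sublocale twisted K M "\<lambda>_ _ x. x"
  by (rule twisted_trivial) unfold_locales

abbreviation \<Phi> where "\<Phi> \<equiv> linear_extension K S \<rho> \<mu>"

lemma \<rho>_closed: "k \<in> carrier K \<Longrightarrow> \<rho> k \<in> carrier S"
  and \<rho>_mult: "\<lbrakk>k \<in> carrier K; l \<in> carrier K\<rbrakk> \<Longrightarrow> \<rho> (k \<otimes>\<^bsub>K\<^esub> l) = \<rho> k \<otimes>\<^bsub>S\<^esub> \<rho> l"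
  and \<rho>_add: "\<lbrakk>k \<in> carrier K; l \<in> carrier K\<rbrakk> \<Longrightarrow> \<rho> (k \<oplus>\<^bsub>K\<^esub> l) = \<rho> k \<oplus>\<^bsub>S\<^esub> \<rho> l"
  and \<rho>_one: "\<rho> \<one>\<^bsub>K\<^esub> = \<one>\<^bsub>S\<^esub>"
  using ring_hom_memE[OF scalars] by auto

lemma \<rho>_zero: "\<rho> \<zero>\<^bsub>K\<^esub> = \<zero>\<^bsub>S\<^esub>"
  using ring_hom_zero[OF scalars] K.ring_axioms S.ring_axioms by blast

lemma extend_superset:
  assumes f: "f \<in> carrier T" and F: "finite F" "{w. f w \<noteq> \<zero>\<^bsub>K\<^esub>} \<subseteq> F" "F \<subseteq> carrier M"
  shows "\<Phi> f = (\<Oplus>\<^bsub>S\<^esub>w\<in>F. \<rho> (f w) \<otimes>\<^bsub>S\<^esub> \<mu> w)"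
  unfolding linear_extension_def
proof (rule S.add.finprod_mono_neutral_cong_left)
  show "(\<lambda>w. \<rho> (f w) \<otimes>\<^bsub>S\<^esub> \<mu> w) \<in> F \<rightarrow> carrier S"
    using carrier_coeff[OF f] F by (auto intro!: \<rho>_closed monoid_closed S.m_closed)
qed (use F monoid_closed in \<open>auto simp: \<rho>_zero\<close>)

lemma extend_closed: "f \<in> carrier T \<Longrightarrow> \<Phi> f \<in> carrier S"
  unfolding linear_extension_def using carrier_coeff[of f] carrier_outside[of f]
  by (intro S.finsum_closed) (auto intro!: \<rho>_closed monoid_closed S.m_closed)

lemma extend_monomial:
  assumes "k \<in> carrier K" "w \<in> carrier M"
  shows "\<Phi> (monomial K k w) = \<rho> k \<otimes>\<^bsub>S\<^esub> \<mu> w"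
proof -
  have "{v. monomial K k w v \<noteq> \<zero>\<^bsub>K\<^esub>} \<subseteq> {w}" by (auto simp: monomial_def)
  then show ?thesis
    using assms extend_superset[of "monomial K k w" "{w}"] by (simp add: \<rho>_closed monoid_closed)
qed

lemma extend_add:
  assumes f: "f \<in> carrier T" and g: "g \<in> carrier T"
  shows "\<Phi> (f \<oplus>\<^bsub>T\<^esub> g) = \<Phi> f \<oplus>\<^bsub>S\<^esub> \<Phi> g"
proof -
  let ?F = "{w. f w \<noteq> \<zero>\<^bsub>K\<^esub>} \<union> {w. g w \<noteq> \<zero>\<^bsub>K\<^esub>}"
  have F: "finite ?F" "?F \<subseteq> carrier M" using f g carrier_finite carrier_outside by auto
  have sub: "{w. f w \<noteq> \<zero>\<^bsub>K\<^esub>} \<subseteq> ?F" "{w. g w \<noteq> \<zero>\<^bsub>K\<^esub>} \<subseteq> ?F" "{w. (f \<oplus>\<^bsub>T\<^esub> g) w \<noteq> \<zero>\<^bsub>K\<^esub>} \<subseteq> ?F"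
    by (auto simp: add_apply)
  note ext = extend_superset[OF f F(1) sub(1) F(2)] extend_superset[OF g F(1) sub(2) F(2)]
    extend_superset[OF add_carrier[OF f g] F(1) sub(3) F(2)]
  have \<mu>: "w \<in> ?F \<Longrightarrow> \<mu> w \<in> carrier S" for w using F(2) monoid_closed by blast
  have r: "\<rho> (f w) \<in> carrier S" "\<rho> (g w) \<in> carrier S" for w
    using carrier_coeff[OF f] carrier_coeff[OF g] \<rho>_closed by blast+
  have "\<Phi> (f \<oplus>\<^bsub>T\<^esub> g) = (\<Oplus>\<^bsub>S\<^esub>w\<in>?F. \<rho> (f w) \<otimes>\<^bsub>S\<^esub> \<mu> w \<oplus>\<^bsub>S\<^esub> \<rho> (g w) \<otimes>\<^bsub>S\<^esub> \<mu> w)"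
    unfolding ext using \<mu> r
    by (intro S.finsum_cong' refl)
      (auto simp: add_apply \<rho>_add carrier_coeff[OF f] carrier_coeff[OF g] S.l_distr)
  also have "\<dots> = \<Phi> f \<oplus>\<^bsub>S\<^esub> \<Phi> g"
    unfolding ext using \<mu> r by (intro S.finsum_addf) auto
  finally show ?thesis .
qed

lemma extend_zero: "\<Phi> \<zero>\<^bsub>T\<^esub> = \<zero>\<^bsub>S\<^esub>"
  using extend_superset[of "\<zero>\<^bsub>T\<^esub>" "{}"] by (auto simp: zero_apply)

lemma extend_mult:
  assumes f: "f \<in> carrier T" and g: "g \<in> carrier T"
  shows "\<Phi> (f \<otimes>\<^bsub>T\<^esub> g) = \<Phi> f \<otimes>\<^bsub>S\<^esub> \<Phi> g"
  using f
proof (induction f rule: monomial_induct)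
  case zero
  then show ?case using g by (simp add: extend_zero extend_closed)
next
  case (add f f')
  then show ?case using g by (simp add: T.l_distr extend_add extend_closed S.l_distr)
next
  case (mono u)
  note u = mono(1) and coeff = carrier_coeff[OF f] carrier_coeff[OF g]
  have m: "monomial K (f u) u \<in> carrier T" using u coeff by simp
  show ?case
    using g
  proof (induction g rule: monomial_induct)
    case zero
    then show ?case using m by (simp add: extend_zero extend_closed)
  next
    case (add f f')
    then show ?case using m by (simp add: T.r_distr extend_add extend_closed S.r_distr)
  next
    case (mono v)
    note v = mono(1)
    have "(\<rho> (f u) \<otimes>\<^bsub>S\<^esub> \<rho> (g v)) \<otimes>\<^bsub>S\<^esub> (\<mu> u \<otimes>\<^bsub>S\<^esub> \<mu> v) = \<rho> (f u) \<otimes>\<^bsub>S\<^esub> (\<rho> (g v) \<otimes>\<^bsub>S\<^esub> \<mu> u) \<otimes>\<^bsub>S\<^esub> \<mu> v"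
      using u v coeff by (simp add: \<rho>_closed monoid_closed S.m_assoc)
    also have "\<dots> = (\<rho> (f u) \<otimes>\<^bsub>S\<^esub> \<mu> u) \<otimes>\<^bsub>S\<^esub> (\<rho> (g v) \<otimes>\<^bsub>S\<^esub> \<mu> v)"
      using u v coeff commute[of "g v" u] by (simp add: \<rho>_closed monoid_closed S.m_assoc)
    finally show ?case
      using u v coeff by (simp add: monomial_mult_monomial extend_monomial \<rho>_mult monoid_mult)
  qed
qed

lemma extend_hom: "\<Phi> \<in> ring_hom (monoid_algebra K M) S"
  unfolding monoid_algebra_eq_twisted
  by (rule ring_hom_memI)
    (simp_all add: extend_closed extend_mult extend_add extend_monomial one_eq_monomial \<rho>_one monoid_one)

end

section \<open>The exterior algebra on its standard basis\<close>

definition subset_monoid :: "nat \<Rightarrow> nat set monoid"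
  where "subset_monoid n = \<lparr>carrier = Pow {1..n}, mult = (\<union>), one = {}\<rparr>"

definition inversions :: "nat set \<Rightarrow> nat set \<Rightarrow> nat"
  where "inversions U V = card {p \<in> U \<times> V. snd p < fst p}"

definition exterior_sign :: "('a, 'm) ring_scheme \<Rightarrow> nat set \<Rightarrow> nat set \<Rightarrow> 'a \<Rightarrow> 'a"
  where "exterior_sign A U V a =
    (if U \<inter> V = {} then if even (inversions U V) then a else \<ominus>\<^bsub>A\<^esub> a else \<zero>\<^bsub>A\<^esub>)"

definition exterior_model :: "('a, 'm) ring_scheme \<Rightarrow> nat \<Rightarrow> ('a, nat set \<Rightarrow> 'a) module"
  where "exterior_model A n = twisted_algebra A (subset_monoid n) (exterior_sign A)"

lemma inversions_Un_left:
  assumes "finite U" "finite V" "finite W" "U \<inter> V = {}"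
  shows "inversions (U \<union> V) W = inversions U W + inversions V W"
proof -
  have "{p \<in> (U \<union> V) \<times> W. snd p < fst p} = {p \<in> U \<times> W. snd p < fst p} \<union> {p \<in> V \<times> W. snd p < fst p}"
    by auto
  then show ?thesis
    unfolding inversions_def using assms by (simp only:) (intro card_Un_disjoint, auto)
qed

lemma inversions_Un_right:
  assumes "finite U" "finite V" "finite W" "V \<inter> W = {}"
  shows "inversions U (V \<union> W) = inversions U V + inversions U W"
proof -
  have "{p \<in> U \<times> (V \<union> W). snd p < fst p} = {p \<in> U \<times> V. snd p < fst p} \<union> {p \<in> U \<times> W. snd p < fst p}"
    by auto
  then show ?thesis
    unfolding inversions_def using assms by (simp only:) (intro card_Un_disjoint, auto)
qed

text \<open>Every pair in \<open>U \<times> V\<close> is an inversion in exactly one of the two orders. For the exterior algebra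
this is graded commutativity: \<open>e\<^sub>U\<close> and \<open>e\<^sub>V\<close> anticommute if both sizes are odd, and commute otherwise.\<close>

lemma inversions_swap:
  assumes "finite U" "finite V" "U \<inter> V = {}"
  shows "inversions U V + inversions V U = card U * card V"
proof -
  have "card {p \<in> V \<times> U. snd p < fst p} = card {p \<in> U \<times> V. fst p < snd p}"
    by (rule bij_betw_same_card[of prod.swap]) (auto simp: bij_betw_def inj_on_def image_def)
  moreover have "card {p \<in> U \<times> V. snd p < fst p} + card {p \<in> U \<times> V. fst p < snd p}
      = card ({p \<in> U \<times> V. snd p < fst p} \<union> {p \<in> U \<times> V. fst p < snd p})"
    using assms by (intro card_Un_disjoint[symmetric]) auto
  moreover have "{p \<in> U \<times> V. snd p < fst p} \<union> {p \<in> U \<times> V. fst p < snd p} = U \<times> V"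
    using assms(3) by (auto simp: set_eq_iff) (metis disjoint_iff linorder_neqE_nat)
  ultimately show ?thesis by (simp add: inversions_def card_cartesian_product)
qed

lemma inversions_empty [simp]: "inversions {} V = 0" "inversions U {} = 0"
  by (simp_all add: inversions_def)

section \<open>Centers\<close>

lemma center_set_closed: "c \<in> center_set A \<Longrightarrow> c \<in> carrier A"
  and center_set_commute: "c \<in> center_set A \<Longrightarrow> a \<in> carrier A \<Longrightarrow> c \<otimes>\<^bsub>A\<^esub> a = a \<otimes>\<^bsub>A\<^esub> c"
  by (simp_all add: center_set_def)

lemma (in ring) center_subcring: "subcring (center_set R) R"
proof -
  have "subring (center_set R) R"
  proof (rule subringI)
    fix x y assume x: "x \<in> center_set R" and y: "y \<in> center_set R"
    note carr = center_set_closed[OF x] center_set_closed[OF y]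
    have "(x \<otimes> y) \<otimes> z = z \<otimes> (x \<otimes> y)" if z: "z \<in> carrier R" for z
    proof -
      have "(x \<otimes> y) \<otimes> z = x \<otimes> (z \<otimes> y)"
        using carr z by (simp only: m_assoc center_set_commute[OF y z])
      also have "\<dots> = (z \<otimes> x) \<otimes> y"
        using carr z by (simp only: m_assoc[symmetric] center_set_commute[OF x z])
      finally show ?thesis using carr z by (simp only: m_assoc)
    qed
    then show "x \<otimes> y \<in> center_set R"
      unfolding center_set_def using carr by blast
  qed (auto simp: center_set_def l_minus r_minus l_distr r_distr)
  then show ?thesis
    by (rule subcringI) (auto intro: center_set_commute center_set_closed)
qed

lemma (in ring) center_set_zero: "\<zero> \<in> center_set R"
  and center_set_one: "\<one> \<in> center_set R"
  and center_set_minus: "c \<in> center_set R \<Longrightarrow> \<ominus> c \<in> center_set R"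
  and center_set_add: "\<lbrakk>c \<in> center_set R; d \<in> center_set R\<rbrakk> \<Longrightarrow> c \<oplus> d \<in> center_set R"
  and center_set_mult: "\<lbrakk>c \<in> center_set R; d \<in> center_set R\<rbrakk> \<Longrightarrow> c \<otimes> d \<in> center_set R"
  using subringE[OF subcring.axioms(1)[OF center_subcring]] by auto

section \<open>The ring on the standard basis and its center\<close>

locale exterior = ring A for A :: "('a, 'm) ring_scheme" (structure) +
  fixes n :: nat
begin

lemma monoid_subset_monoid: "monoid (subset_monoid n)"
  by (rule monoidI) (auto simp: subset_monoid_def)

lemma finite_index: "U \<in> carrier (subset_monoid n) \<Longrightarrow> finite U"
  by (auto simp: subset_monoid_def intro: finite_subset)

sublocale E: twisted A "subset_monoid n" "exterior_sign A"
proof (intro twisted.intro twisted_axioms.intro ring_axioms monoid_subset_monoid)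
  fix U V W a
  assume UVW: "U \<in> carrier (subset_monoid n)" "V \<in> carrier (subset_monoid n)" "W \<in> carrier (subset_monoid n)"
    and a: "a \<in> carrier A"
  then have fin: "finite U" "finite V" "finite W" using finite_index by auto
  show "exterior_sign A (U \<otimes>\<^bsub>subset_monoid n\<^esub> V) W (exterior_sign A U V a) =
        exterior_sign A U (V \<otimes>\<^bsub>subset_monoid n\<^esub> W) (exterior_sign A V W a)"
  proof (cases "U \<inter> V = {} \<and> U \<inter> W = {} \<and> V \<inter> W = {}")
    case True
    then have "inversions (U \<union> V) W + inversions U V = inversions U (V \<union> W) + inversions V W"
      using fin by (simp add: inversions_Un_left inversions_Un_right)
    \<comment> \<open>Both composites change the sign by the parity of the inversions among all three sets.\<close>
    then have "even (inversions (U \<union> V) W) = even (inversions U V) \<longleftrightarrow>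
      even (inversions U (V \<union> W)) = even (inversions V W)"
      by (metis even_add)
    then show ?thesis
      using True a by (auto simp: exterior_sign_def subset_monoid_def Int_Un_distrib Int_Un_distrib2)
  next
    case False
    then show ?thesis
      by (auto simp: exterior_sign_def subset_monoid_def Int_Un_distrib Int_Un_distrib2)
  qed
qed (auto simp: exterior_sign_def subset_monoid_def minus_add l_minus r_minus a_comm)

abbreviation E where "E \<equiv> exterior_model A n"

abbreviation top where "top \<equiv> {1..n}"

lemmas sign_closed = E.tw_closed

lemma exterior_model_eq: "exterior_model A n = twisted_algebra A (subset_monoid n) (exterior_sign A)"
  by (rule exterior_model_def)

lemma index [simp]: "U \<in> carrier (subset_monoid n) \<longleftrightarrow> U \<subseteq> top"
  "U \<otimes>\<^bsub>subset_monoid n\<^esub> V = U \<union> V" "\<one>\<^bsub>subset_monoid n\<^esub> = {}"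
  by (auto simp: subset_monoid_def)

end

lemma (in ring) ring_exterior_model: "ring (exterior_model R n)"
proof -
  interpret exterior R n by unfold_locales
  show ?thesis unfolding exterior_model_eq by (rule E.ring_twisted)
qed

context exterior
begin

lemmas E_induct = E.monomial_induct[folded exterior_model_eq, consumes 1, case_names zero mono add]
lemmas coeff = E.carrier_coeff[folded exterior_model_eq]
lemmas outside = E.carrier_outside[folded exterior_model_eq, unfolded index]
lemmas E_add = E.add_apply[folded exterior_model_eq]
lemmas E_zero = E.zero_apply[folded exterior_model_eq]
lemmas monomial_closed_E = E.monomial_closed[folded exterior_model_eq, unfolded index]
lemmas monomial_mult = E.monomial_mult_monomial[folded exterior_model_eq, unfolded index]
lemmas monomial_add_E = E.monomial_add[folded exterior_model_eq]
lemmas monomial_zero_E = E.monomial_zero[folded exterior_model_eq]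
lemmas E_one = E.one_eq_monomial[folded exterior_model_eq, unfolded index]

sublocale L: ring E
  by (rule ring_exterior_model)

lemma sign_zero: "exterior_sign A U V \<zero> = \<zero>"
  by (simp add: exterior_sign_def)

text \<open>At most one coefficient of \<open>f\<close> contributes to each coefficient of \<open>f e\<^sub>V\<close>, because \<open>U \<union> V = S\<close> with
\<open>U\<close> disjoint from \<open>V\<close> forces \<open>U = S - V\<close>.\<close>

lemma mult_monomial_apply:
  assumes f: "f \<in> carrier E" and b: "b \<in> carrier A" and V: "V \<subseteq> top"
  shows "(f \<otimes>\<^bsub>E\<^esub> monomial A b V) S = (if V \<subseteq> S then exterior_sign A (S - V) V (f (S - V) \<otimes> b) else \<zero>)"
  using f
proof (induction f rule: E_induct)
  case zero
  then show ?case using b V by (simp add: monomial_closed_E E_zero[of S] E_zero[of "S - V"] sign_zero)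
next
  case (add g h)
  then show ?case
    using b V E.tw_add[of "S - V" V] coeff[OF add(1)] coeff[OF add(2)] outside[OF add(1), of "S - V"]
      outside[OF add(2), of "S - V"]
    by (cases "S - V \<subseteq> top") (auto simp: L.l_distr monomial_closed_E E_add[of _ _ S] E_add[of _ _ "S - V"] l_distr sign_zero)
next
  case (mono U)
  have prod: "monomial A (f U) U \<otimes>\<^bsub>E\<^esub> monomial A b V = monomial A (exterior_sign A U V (f U \<otimes> b)) (U \<union> V)"
    using mono b V coeff[OF f] by (simp add: monomial_mult)
  show ?case
  proof (cases "U \<inter> V = {} \<and> S = U \<union> V")
    case True
    then have "S - V = U" "V \<subseteq> S" by auto
    then show ?thesis unfolding prod using True by (simp add: Un_commute)
  next
    case False
    then have "exterior_sign A U V (f U \<otimes> b) = \<zero> \<or> S \<noteq> U \<union> V"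
      by (auto simp: exterior_sign_def)
    then have "monomial A (exterior_sign A U V (f U \<otimes> b)) (U \<union> V) S = \<zero>"
      by (auto simp: monomial_apply_neq monomial_def)
    moreover have "S - V \<noteq> U" if "V \<subseteq> S" using that False by blast
    ultimately show ?thesis unfolding prod using b by (simp add: monomial_apply_neq sign_zero)
  qed
qed

lemma monomial_mult_apply:
  assumes f: "f \<in> carrier E" and b: "b \<in> carrier A" and V: "V \<subseteq> top"
  shows "(monomial A b V \<otimes>\<^bsub>E\<^esub> f) S = (if V \<subseteq> S then exterior_sign A V (S - V) (b \<otimes> f (S - V)) else \<zero>)"
  using f
proof (induction f rule: E_induct)
  case zero
  then show ?case using b V by (simp add: monomial_closed_E E_zero[of S] E_zero[of "S - V"] sign_zero)
next
  case (add g h)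
  then show ?case
    using b V E.tw_add[of V "S - V"] coeff[OF add(1)] coeff[OF add(2)] outside[OF add(1), of "S - V"]
      outside[OF add(2), of "S - V"]
    by (cases "S - V \<subseteq> top") (auto simp: L.r_distr monomial_closed_E E_add[of _ _ S] E_add[of _ _ "S - V"] r_distr sign_zero)
next
  case (mono U)
  have prod: "monomial A b V \<otimes>\<^bsub>E\<^esub> monomial A (f U) U = monomial A (exterior_sign A V U (b \<otimes> f U)) (V \<union> U)"
    using mono b V coeff[OF f] by (simp add: monomial_mult)
  show ?case
  proof (cases "U \<inter> V = {} \<and> S = U \<union> V")
    case True
    then have "S - V = U" "V \<subseteq> S" by auto
    then show ?thesis unfolding prod using True by (simp add: Un_commute)
  next
    case False
    then have "exterior_sign A V U (b \<otimes> f U) = \<zero> \<or> S \<noteq> V \<union> U"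
      by (auto simp: exterior_sign_def)
    then have "monomial A (exterior_sign A V U (b \<otimes> f U)) (V \<union> U) S = \<zero>"
      by (auto simp: monomial_apply_neq monomial_def)
    moreover have "S - V \<noteq> U" if "V \<subseteq> S" using that False by blast
    ultimately show ?thesis unfolding prod using b by (simp add: monomial_apply_neq sign_zero)
  qed
qed

text \<open>Commuting with the constants puts the coefficients in the center of \<open>A\<close>, and commuting with some
\<open>e\<^sub>i\<close>, \<open>i \<notin> S\<close>, gives \<open>f(S) = -f(S)\<close> for odd \<open>|S|\<close>. For the whole index set there is no such \<open>i\<close>.
Conversely, the only sign that can obstruct commutation arises between \<open>e\<^sub>U\<close> and \<open>e\<^sub>V\<close> with both sizes
odd and \<open>U\<close>, \<open>V\<close> disjoint; then \<open>U\<close> is not the whole index set, so its coefficient absorbs the sign.\<close>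

lemma central_iff:
  "f \<in> center_set E \<longleftrightarrow> f \<in> carrier E \<and>
    (\<forall>S. f S \<in> center_set A \<and> (odd (card S) \<and> S \<noteq> top \<longrightarrow> f S \<oplus> f S = \<zero>))"
proof (intro iffI conjI allI impI)
  assume f: "f \<in> center_set E"
  then show fE: "f \<in> carrier E" by (rule center_set_closed)
  have comm: "(f \<otimes>\<^bsub>E\<^esub> g) S = (g \<otimes>\<^bsub>E\<^esub> f) S" if "g \<in> carrier E" for g S
    using center_set_commute[OF f that] by simp
  fix S
  show "f S \<in> center_set A"
    unfolding center_set_def
  proof (intro CollectI conjI ballI)
    fix a assume a: "a \<in> carrier A"
    show "f S \<otimes> a = a \<otimes> f S"
      using comm[OF monomial_closed_E[OF a, of "{}"], of S] a coeff[OF fE]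
      by (simp add: mult_monomial_apply monomial_mult_apply fE exterior_sign_def)
  qed (rule coeff[OF fE])
  assume S: "odd (card S) \<and> S \<noteq> top"
  show "f S \<oplus> f S = \<zero>"
  proof (cases "S \<subseteq> top")
    case False
    then show ?thesis using outside[OF fE] by simp
  next
    case True
    then obtain i where i: "i \<in> top" "i \<notin> S" using S by blast
    have fin: "finite S" using True finite_subset by blast
    have "inversions S {i} + inversions {i} S = card S"
      using inversions_swap[OF fin, of "{i}"] i by simp
    then have "odd (inversions S {i}) \<longleftrightarrow> even (inversions {i} S)"
      using S by (metis even_add)
    moreover have "insert i S - {i} = S" using i by auto
    ultimately have "f S = \<ominus> f S"
      using comm[OF monomial_closed_E[OF one_closed, of "{i}"], of "insert i S"] coeff[OF fE] i
      by (auto simp: mult_monomial_apply monomial_mult_apply fE exterior_sign_def split: if_splits)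
    then show ?thesis
      using coeff[OF fE, of S] by (metis r_neg)
  qed
next
  assume f: "f \<in> carrier E \<and>
    (\<forall>S. f S \<in> center_set A \<and> (odd (card S) \<and> S \<noteq> top \<longrightarrow> f S \<oplus> f S = \<zero>))"
  then have fE: "f \<in> carrier E" by simp
  have "f \<otimes>\<^bsub>E\<^esub> g = g \<otimes>\<^bsub>E\<^esub> f" if g: "g \<in> carrier E" for g
    using fE
  proof (induction f rule: E_induct)
    case zero
    then show ?case using g by simp
  next
    case (add f f')
    then show ?case using g by (simp add: L.l_distr L.r_distr)
  next
    case (mono U)
    note U = mono(1)[unfolded index]
    have m: "monomial A (f U) U \<in> carrier E" using U coeff[OF fE] by (rule monomial_closed_E[rotated])
    show ?case
      using g
    proof (induction g rule: E_induct)
      case zero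
      then show ?case using m by simp
    next
      case (add f f')
      then show ?case using m by (simp add: L.l_distr L.r_distr)
    next
      case (mono V)
      note V = mono(1)[unfolded index]
      have comm: "f U \<otimes> g V = g V \<otimes> f U"
        using f coeff[OF g] by (simp add: center_set_def)
      have "exterior_sign A U V (f U \<otimes> g V) = exterior_sign A V U (f U \<otimes> g V)"
      proof (cases "U \<inter> V = {}")
        case True
        have fin: "finite U" "finite V" using U V finite_subset by blast+
        have inv: "inversions U V + inversions V U = card U * card V"
          using inversions_swap[OF fin True] .
        show ?thesis
        proof (cases "odd (card U) \<and> odd (card V)")
          case True
          then have "U \<noteq> top" using \<open>U \<inter> V = {}\<close> V by (auto simp: Int_absorb1)
          then have "f U \<oplus> f U = \<zero>" using f True by blast
          then have "f U \<otimes> g V \<oplus> f U \<otimes> g V = \<zero>"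
            using coeff[OF fE] coeff[OF g] by (simp flip: l_distr)
          then have "\<ominus> (f U \<otimes> g V) = f U \<otimes> g V"
            using coeff[OF fE] coeff[OF g] by (simp add: minus_equality)
          then show ?thesis by (simp add: exterior_sign_def Int_commute)
        next
          case False
          then have "even (inversions U V + inversions V U)" unfolding inv by auto
          then have "even (inversions U V) \<longleftrightarrow> even (inversions V U)" by simp
          then show ?thesis by (simp add: exterior_sign_def Int_commute)
        qed
      qed (auto simp: exterior_sign_def)
      then show ?case
        using U V coeff[OF fE] coeff[OF g] by (simp add: monomial_mult comm Un_commute)
    qed
  qed
  then show "f \<in> center_set E" using fE by (simp add: center_set_def)
qed

end

section \<open>Central essentiality, element by element\<close>

context ring
begin

lemma submodule_over_center_iff:
  "submodule N (center_ring R) (center_module R) \<longleftrightarrow>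
    N \<subseteq> carrier R \<and> \<zero> \<in> N \<and> (\<forall>x\<in>N. \<forall>y\<in>N. x \<oplus> y \<in> N) \<and> (\<forall>x\<in>N. \<ominus> x \<in> N) \<and>
    (\<forall>x\<in>N. \<forall>c\<in>center_set R. x \<otimes> c \<in> N)"
proof -
  have "m_inv (add_monoid (center_module R)) x = \<ominus> x" for x
    by (simp add: m_inv_def a_inv_def center_module_def)
  then show ?thesis
    by (auto simp: submodule_def submodule_axioms_def subgroup_def center_module_def center_ring_def)
qed

text \<open>It suffices to test essentiality on the cyclic submodules \<open>r C\<close>, since every nonzero submodule
contains one.\<close>

lemma essential_over_center_iff:
  assumes N: "submodule N (center_ring R) (center_module R)"
  shows "essential_submodule N (center_ring R) (center_module R) \<longleftrightarrow>
    (\<forall>r\<in>carrier R. r \<noteq> \<zero> \<longrightarrow> (\<exists>c\<in>center_set R. r \<otimes> c \<noteq> \<zero> \<and> r \<otimes> c \<in> N))"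
proof
  assume ess: "essential_submodule N (center_ring R) (center_module R)"
  show "\<forall>r\<in>carrier R. r \<noteq> \<zero> \<longrightarrow> (\<exists>c\<in>center_set R. r \<otimes> c \<noteq> \<zero> \<and> r \<otimes> c \<in> N)"
  proof (intro ballI impI)
    fix r assume r: "r \<in> carrier R" "r \<noteq> \<zero>"
    let ?L = "(\<lambda>c. r \<otimes> c) ` center_set R"
    have "submodule ?L (center_ring R) (center_module R)"
      unfolding submodule_over_center_iff
    proof (intro conjI ballI)
      show "?L \<subseteq> carrier R" using r by (auto dest: center_set_closed)
      show "\<zero> \<in> ?L" using r center_set_zero by (intro image_eqI[of _ _ \<zero>]) auto
      fix x assume "x \<in> ?L"
      then obtain c where c: "c \<in> center_set R" "x = r \<otimes> c" by auto
      show "\<ominus> x \<in> ?L"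
        using c r center_set_minus[OF c(1)] center_set_closed[OF c(1)]
        by (intro image_eqI[of _ _ "\<ominus> c"]) (auto simp: r_minus)
      {
        fix y assume "y \<in> ?L"
        then obtain d where d: "d \<in> center_set R" "y = r \<otimes> d" by auto
        show "x \<oplus> y \<in> ?L"
          using c d r center_set_add[OF c(1) d(1)] center_set_closed[OF c(1)] center_set_closed[OF d(1)]
          by (intro image_eqI[of _ _ "c \<oplus> d"]) (auto simp: r_distr)
      }
      {
        fix d assume d: "d \<in> center_set R"
        show "x \<otimes> d \<in> ?L"
          using c d r center_set_mult[OF c(1) d] center_set_closed[OF c(1)] center_set_closed[OF d]
          by (intro image_eqI[of _ _ "c \<otimes> d"]) (auto simp: m_assoc)
      }
    qed
    moreover have "r \<in> ?L"
      using r center_set_one by (intro image_eqI[of _ _ \<one>]) auto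
    ultimately have "N \<inter> ?L \<noteq> {\<zero>}"
      using ess r unfolding essential_submodule_def by (auto simp: center_module_def)
    moreover have "\<zero> \<in> N \<inter> ?L"
      using N \<open>submodule ?L (center_ring R) (center_module R)\<close>
      by (simp only: submodule_over_center_iff) blast
    ultimately show "\<exists>c\<in>center_set R. r \<otimes> c \<noteq> \<zero> \<and> r \<otimes> c \<in> N" by blast
  qed
next
  assume elem: "\<forall>r\<in>carrier R. r \<noteq> \<zero> \<longrightarrow> (\<exists>c\<in>center_set R. r \<otimes> c \<noteq> \<zero> \<and> r \<otimes> c \<in> N)"
  show "essential_submodule N (center_ring R) (center_module R)"
    unfolding essential_submodule_def
  proof (intro conjI allI impI N)
    fix L assume L: "submodule L (center_ring R) (center_module R) \<and> L \<noteq> {\<zero>\<^bsub>center_module R\<^esub>}"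
    then have "\<zero> \<in> L" "L \<subseteq> carrier R" by (simp_all add: submodule_over_center_iff)
    then obtain r where r: "r \<in> L" "r \<noteq> \<zero>" "r \<in> carrier R"
      using L by (auto simp: center_module_def)
    then obtain c where "c \<in> center_set R" "r \<otimes> c \<noteq> \<zero>" "r \<otimes> c \<in> N" using elem by blast
    moreover from this have "r \<otimes> c \<in> L" using L r by (simp add: submodule_over_center_iff)
    ultimately show "N \<inter> L \<noteq> {\<zero>\<^bsub>center_module R\<^esub>}" by (auto simp: center_module_def)
  qed
qed

lemma center_submodule: "submodule (center_set R) (center_ring R) (center_module R)"
  unfolding submodule_over_center_iff
  by (intro conjI ballI subsetI center_set_zero center_set_add center_set_minus center_set_mult)
    (rule center_set_closed)

lemma annihilator_of_two_eq: "annihilator_of_two R = {a \<in> carrier R. a \<oplus> a = \<zero>}"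
  by (auto simp: annihilator_of_two_def numeral_2_eq_2 add.nat_pow_Suc)

lemma annihilator_of_two_submodule:
  "submodule (annihilator_of_two R) (center_ring R) (center_module R)"
  unfolding submodule_over_center_iff annihilator_of_two_eq
proof (intro conjI ballI)
  fix x assume x: "x \<in> {a \<in> carrier R. a \<oplus> a = \<zero>}"
  show "\<ominus> x \<in> {a \<in> carrier R. a \<oplus> a = \<zero>}"
    using x minus_add[of x x] by simp
  fix y assume y: "y \<in> {a \<in> carrier R. a \<oplus> a = \<zero>}"
  have "(x \<oplus> y) \<oplus> (x \<oplus> y) = (x \<oplus> x) \<oplus> (y \<oplus> y)"
    using x y a_lcomm[of y x y] by (simp add: a_assoc)
  then show "x \<oplus> y \<in> {a \<in> carrier R. a \<oplus> a = \<zero>}" using x y by simp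
next
  fix x c assume "x \<in> {a \<in> carrier R. a \<oplus> a = \<zero>}" "c \<in> center_set R"
  then show "x \<otimes> c \<in> {a \<in> carrier R. a \<oplus> a = \<zero>}"
    using center_set_closed[of c R] by (simp add: l_distr[symmetric])
qed auto

lemma centrally_essential_iff:
  "centrally_essential R \<longleftrightarrow>
    (\<forall>r\<in>carrier R. r \<noteq> \<zero> \<longrightarrow> (\<exists>c\<in>center_set R. r \<otimes> c \<noteq> \<zero> \<and> r \<otimes> c \<in> center_set R))"
  unfolding centrally_essential_def by (rule essential_over_center_iff[OF center_submodule])

end

lemma ring_iso_center:
  assumes "\<phi> \<in> ring_iso R S" "c \<in> center_set R"
  shows "\<phi> c \<in> center_set S"
proof -
  have hom: "\<phi> \<in> ring_hom R S" and onto: "\<phi> ` carrier R = carrier S"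
    using assms(1) by (auto simp: ring_iso_def bij_betw_def)
  have "\<phi> c \<otimes>\<^bsub>S\<^esub> y = y \<otimes>\<^bsub>S\<^esub> \<phi> c" if y: "y \<in> carrier S" for y
  proof -
    obtain x where x: "x \<in> carrier R" "y = \<phi> x" using y onto by auto
    show ?thesis
      unfolding x(2) using center_set_commute[OF assms(2) x(1)] center_set_closed[OF assms(2)] x(1)
      by (metis ring_hom_mult[OF hom])
  qed
  then show ?thesis
    using center_set_closed[OF assms(2)] ring_hom_closed[OF hom] by (auto simp: center_set_def)
qed

lemma centrally_essential_ring_iso:
  assumes R: "ring R" and S: "ring S" and \<phi>: "\<phi> \<in> ring_iso R S" and ess: "centrally_essential R"
  shows "centrally_essential S"
  unfolding ring.centrally_essential_iff[OF S]
proof (intro ballI impI)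
  have hom: "\<phi> \<in> ring_hom R S" and bij: "bij_betw \<phi> (carrier R) (carrier S)"
    using \<phi> by (auto simp: ring_iso_def)
  have zero: "\<phi> \<zero>\<^bsub>R\<^esub> = \<zero>\<^bsub>S\<^esub>" using ring_hom_zero[OF hom R S] .
  fix s assume s: "s \<in> carrier S" "s \<noteq> \<zero>\<^bsub>S\<^esub>"
  then obtain r where r: "r \<in> carrier R" "s = \<phi> r" "r \<noteq> \<zero>\<^bsub>R\<^esub>"
    using bij zero by (auto simp: bij_betw_def)
  then obtain c where c: "c \<in> center_set R" "r \<otimes>\<^bsub>R\<^esub> c \<noteq> \<zero>\<^bsub>R\<^esub>" "r \<otimes>\<^bsub>R\<^esub> c \<in> center_set R"
    using ess ring.centrally_essential_iff[OF R] by blast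
  have cR: "c \<in> carrier R" "r \<otimes>\<^bsub>R\<^esub> c \<in> carrier R" by (fact center_set_closed[OF c(1)] center_set_closed[OF c(3)])+
  have eq: "s \<otimes>\<^bsub>S\<^esub> \<phi> c = \<phi> (r \<otimes>\<^bsub>R\<^esub> c)" using r cR ring_hom_mult[OF hom] by simp
  have "\<phi> (r \<otimes>\<^bsub>R\<^esub> c) \<noteq> \<phi> \<zero>\<^bsub>R\<^esub>"
    using inj_on_eq_iff[OF bij_betw_imp_inj_on[OF bij] cR(2) ring.ring_simprules(2)[OF R]] c(2) by blast
  then show "\<exists>c\<in>center_set S. s \<otimes>\<^bsub>S\<^esub> c \<noteq> \<zero>\<^bsub>S\<^esub> \<and> s \<otimes>\<^bsub>S\<^esub> c \<in> center_set S"
    using ring_iso_center[OF \<phi>] c eq zero by (intro bexI[of _ "\<phi> c"]) auto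
qed

section \<open>Central essentiality of the exterior algebra\<close>

context exterior
begin

lemma mult_scalar_apply:
  assumes "f \<in> carrier E" "a \<in> carrier A"
  shows "(f \<otimes>\<^bsub>E\<^esub> monomial A a {}) S = f S \<otimes> a"
  using assms coeff[OF assms(1)] by (simp add: mult_monomial_apply exterior_sign_def)

lemma monomial_central:
  assumes c: "c \<in> center_set A" and V: "V \<subseteq> top" "even (card V)"
  shows "monomial A c V \<in> center_set E"
  unfolding central_iff
proof (intro conjI allI impI)
  show "monomial A c V \<in> carrier E" using center_set_closed[OF c] V(1) by (rule monomial_closed_E)
  fix S
  show "monomial A c V S \<in> center_set A"
    using c center_set_zero by (cases "S = V") (simp_all add: monomial_apply_neq)
  assume "odd (card S) \<and> S \<noteq> top"
  then have "S \<noteq> V" using V(2) by auto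
  then show "monomial A c V S \<oplus> monomial A c V S = \<zero>" by (simp add: monomial_apply_neq)
qed

lemma scalar_central: "c \<in> center_set A \<Longrightarrow> monomial A c {} \<in> center_set E"
  by (rule monomial_central) auto

lemma E_nonzero_iff: "f \<noteq> \<zero>\<^bsub>E\<^esub> \<longleftrightarrow> (\<exists>S. f S \<noteq> \<zero>)"
  unfolding fun_eq_iff E_zero by blast

lemma finite_support: "f \<in> carrier E \<Longrightarrow> finite {S. f S \<noteq> \<zero>}"
  using E.carrier_finite[folded exterior_model_eq] .

text \<open>Essentiality moves one coefficient into \<open>N\<close> and keeps it nonzero. Coefficients already in \<open>N\<close> stay
there, because \<open>N\<close> is a submodule, so the number of coefficients outside \<open>N\<close> decreases.\<close>

lemma scale_coefficients_into:
  assumes ess: "essential_submodule N (center_ring A) (center_module A)"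
    and f: "f \<in> carrier E" "f \<noteq> \<zero>\<^bsub>E\<^esub>"
  shows "\<exists>c\<in>center_set A. f \<otimes>\<^bsub>E\<^esub> monomial A c {} \<noteq> \<zero>\<^bsub>E\<^esub> \<and> (\<forall>S. f S \<otimes> c \<in> N)"
  using f
proof (induction "card {S. f S \<notin> N}" arbitrary: f rule: less_induct)
  case less
  have N: "submodule N (center_ring A) (center_module A)"
    using ess by (simp add: essential_submodule_def)
  have N': "\<zero> \<in> N" "\<And>x c. x \<in> N \<Longrightarrow> c \<in> center_set A \<Longrightarrow> x \<otimes> c \<in> N"
    using N by (auto simp: submodule_over_center_iff)
  have one: "\<one> \<in> center_set A" by (rule center_set_one)
  show ?case
  proof (cases "\<forall>S. f S \<in> N")
    case True
    then show ?thesis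
      using less.prems one coeff[OF less.prems(1)]
      by (intro bexI[of _ \<one>]) (auto simp: E_one[symmetric])
  next
    case False
    then obtain S where S: "f S \<notin> N" by auto
    then have "f S \<noteq> \<zero>" using N'(1) by auto
    then obtain c where c: "c \<in> center_set A" "f S \<otimes> c \<noteq> \<zero>" "f S \<otimes> c \<in> N"
      using ess coeff[OF less.prems(1)] unfolding essential_over_center_iff[OF N] by blast
    note cA = center_set_closed[OF c(1)]
    define g where "g = f \<otimes>\<^bsub>E\<^esub> monomial A c {}"
    have g: "g \<in> carrier E" using less.prems cA by (simp add: g_def monomial_closed_E)
    have gS: "g U = f U \<otimes> c" for U
      unfolding g_def using less.prems(1) cA by (rule mult_scalar_apply)
    have nz: "g \<noteq> \<zero>\<^bsub>E\<^esub>" using c gS E_nonzero_iff by metis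
    have "{U. g U \<notin> N} \<subset> {U. f U \<notin> N}"
      using S c N'(2) gS by auto
    moreover have "finite {U. f U \<notin> N}"
      by (rule finite_subset[OF _ finite_support[OF less.prems(1)]]) (use N'(1) in auto)
    ultimately have "card {U. g U \<notin> N} < card {U. f U \<notin> N}"
      by (simp add: psubset_card_mono)
    from less.hyps[OF this g nz] obtain d where d: "d \<in> center_set A"
      "g \<otimes>\<^bsub>E\<^esub> monomial A d {} \<noteq> \<zero>\<^bsub>E\<^esub>" "\<forall>S. g S \<otimes> d \<in> N" by blast
    note dA = center_set_closed[OF d(1)]
    have "g \<otimes>\<^bsub>E\<^esub> monomial A d {} = f \<otimes>\<^bsub>E\<^esub> monomial A (c \<otimes> d) {}"
      unfolding g_def using less.prems cA dA
      by (simp add: L.m_assoc monomial_closed_E monomial_mult exterior_sign_def)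
    moreover have "g U \<otimes> d = f U \<otimes> (c \<otimes> d)" for U
      unfolding gS using coeff[OF less.prems(1)] cA dA by (simp add: m_assoc)
    ultimately show ?thesis
      using d center_set_mult[OF c(1) d(1)] by (intro bexI[of _ "c \<otimes> d"]) auto
  qed
qed

text \<open>If some odd coefficient is nonzero, take \<open>S\<close> of least odd size among those and multiply by
\<open>e\<^sub>V\<close>, where \<open>V\<close> is the complement of \<open>S\<close>. Then \<open>|V| = n - |S|\<close> is even, so \<open>e\<^sub>V\<close> is central. The term
of a set \<open>U\<close> survives only if \<open>U \<subseteq> S\<close>, and then has degree \<open>|U| + |V|\<close>, which has the parity of \<open>|U|\<close>.
By minimality of \<open>S\<close> the only odd term of the product is the one in top degree.\<close>

lemma central_multiple_of_central_coefficients: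
  assumes n: "odd n" and f: "f \<in> carrier E" "f \<noteq> \<zero>\<^bsub>E\<^esub>" and cent: "\<And>S. f S \<in> center_set A"
  shows "\<exists>z\<in>center_set E. f \<otimes>\<^bsub>E\<^esub> z \<noteq> \<zero>\<^bsub>E\<^esub> \<and> f \<otimes>\<^bsub>E\<^esub> z \<in> center_set E"
proof (cases "\<exists>S. odd (card S) \<and> f S \<noteq> \<zero>")
  case False
  then have "f \<in> center_set E" using f cent by (auto simp: central_iff)
  moreover have "\<one>\<^bsub>E\<^esub> \<in> center_set E" by (rule L.center_set_one)
  ultimately show ?thesis using f by (intro bexI[of _ "\<one>\<^bsub>E\<^esub>"]) auto
next
  case True
  let ?P = "\<lambda>S. odd (card S) \<and> f S \<noteq> \<zero>"
  obtain S where S: "?P S" and min: "\<And>U. ?P U \<Longrightarrow> card S \<le> card U"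
    using True ex_has_least_nat[of ?P _ card] by blast
  have sub: "S \<subseteq> top" using S outside[OF f(1)] by blast
  let ?V = "top - S"
  let ?z = "monomial A \<one> ?V"
  have fin: "finite S" using sub finite_subset by blast
  have "card ?V = n - card S" using sub fin by (simp add: card_Diff_subset)
  moreover have "card S \<le> n" using sub card_mono[of top S] by simp
  ultimately have even: "even (card ?V)" using n S by simp
  have z: "?z \<in> center_set E"
    using even by (intro monomial_central center_set_one) auto
  have zE: "?z \<in> carrier E" using z by (rule center_set_closed)
  have app: "(f \<otimes>\<^bsub>E\<^esub> ?z) U = (if ?V \<subseteq> U then exterior_sign A (U - ?V) ?V (f (U - ?V)) else \<zero>)" for U
    using mult_monomial_apply[OF f(1) one_closed, of ?V U] coeff[OF f(1)] by simp
  have "top - ?V = S" using sub by auto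
  then have "(f \<otimes>\<^bsub>E\<^esub> ?z) top \<noteq> \<zero>"
    unfolding app using S coeff[OF f(1), of S] by (auto simp: exterior_sign_def)
  then have nz: "f \<otimes>\<^bsub>E\<^esub> ?z \<noteq> \<zero>\<^bsub>E\<^esub>" using E_nonzero_iff by blast
  have "f \<otimes>\<^bsub>E\<^esub> ?z \<in> center_set E"
    unfolding central_iff
  proof (intro conjI allI impI)
    show "f \<otimes>\<^bsub>E\<^esub> ?z \<in> carrier E" using f zE by simp
    fix U
    show "(f \<otimes>\<^bsub>E\<^esub> ?z) U \<in> center_set A"
      unfolding app using cent center_set_zero center_set_minus by (auto simp: exterior_sign_def)
    assume U: "odd (card U) \<and> U \<noteq> top"
    have "(f \<otimes>\<^bsub>E\<^esub> ?z) U = \<zero>"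
    proof (rule ccontr)
      assume "(f \<otimes>\<^bsub>E\<^esub> ?z) U \<noteq> \<zero>"
      then have V: "?V \<subseteq> U" and nz: "f (U - ?V) \<noteq> \<zero>"
        unfolding app by (auto simp: sign_zero split: if_splits)
      have "U - ?V \<subseteq> top" using nz outside[OF f(1), of "U - ?V"] by argo
      then have sub': "U - ?V \<subseteq> S" by auto
      then have "finite U"
        using fin V finite_subset[of U "S \<union> ?V"] by auto
      then have "card U = card (U - ?V) + card ?V"
        using V by (metis card_Diff_subset card_mono finite_subset le_add_diff_inverse2)
      then have "odd (card (U - ?V))" using U even by simp
      then have "card S \<le> card (U - ?V)" using min nz by blast
      then have "U - ?V = S" using sub' fin by (meson card_seteq)
      then have "U = top" using V sub by auto
      then show False using U by simp
    qed
    then show "(f \<otimes>\<^bsub>E\<^esub> ?z) U \<oplus> (f \<otimes>\<^bsub>E\<^esub> ?z) U = \<zero>" by simp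
  qed
  then show ?thesis using z nz by blast
qed

text \<open>Tested on \<open>a e\<^sub>T\<close> with \<open>T = {1..n}\<close>: every product with it is \<open>a c e\<^sub>T\<close>, where \<open>c\<close> is the constant
coefficient of the multiplier.\<close>

lemma E_centrally_essential_imp_base:
  assumes ess: "centrally_essential E"
  shows "centrally_essential A"
  unfolding centrally_essential_iff
proof (intro ballI impI)
  fix a assume a: "a \<in> carrier A" "a \<noteq> \<zero>"
  let ?x = "monomial A a top"
  have x: "?x \<in> carrier E" using a by (simp add: monomial_closed_E)
  have "?x \<noteq> \<zero>\<^bsub>E\<^esub>" using a E_nonzero_iff[of ?x] monomial_apply by metis
  then obtain z where z: "z \<in> center_set E" "?x \<otimes>\<^bsub>E\<^esub> z \<noteq> \<zero>\<^bsub>E\<^esub>" "?x \<otimes>\<^bsub>E\<^esub> z \<in> center_set E"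
    using ess x L.centrally_essential_iff by blast
  note zE = center_set_closed[OF z(1)]
  have app: "(?x \<otimes>\<^bsub>E\<^esub> z) S = (if S = top then a \<otimes> z {} else \<zero>)" for S
  proof (cases "S \<subseteq> top")
    case True
    then show ?thesis
      using a coeff[OF zE] by (auto simp: monomial_mult_apply[OF zE] exterior_sign_def)
  next
    case False
    then show ?thesis using outside[OF L.m_closed[OF x zE]] by auto
  qed
  have zc: "z {} \<in> center_set A" using z(1) by (simp add: central_iff)
  have "a \<otimes> z {} \<noteq> \<zero>" using z(2) app E_nonzero_iff by metis
  moreover have "a \<otimes> z {} \<in> center_set A"
    using z(3) app[of top] by (metis central_iff)
  ultimately show "\<exists>c\<in>center_set A. a \<otimes> c \<noteq> \<zero> \<and> a \<otimes> c \<in> center_set A"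
    using zc by blast
qed

text \<open>Tested on \<open>x = a e\<^sub>U\<close> with \<open>U = {1..n-1}\<close>. For a central \<open>z\<close>, the product \<open>x z\<close> has only the coefficients
\<open>a z({})\<close> and \<open>\<plusminus>a z({n})\<close>. The first sits in the odd degree \<open>n - 1\<close> and is killed by \<open>2\<close> because \<open>x z\<close>
is central. The second is killed by \<open>2\<close> because \<open>z\<close> is central and \<open>{n}\<close> has odd size and, for
even \<open>n\<close>, is not the whole index set. Whichever is nonzero is the required multiple of \<open>a\<close>.\<close>

lemma E_centrally_essential_imp_annihilator:
  assumes ess: "centrally_essential E" and n: "even n" "n \<ge> 1"
  shows "essential_submodule (annihilator_of_two A) (center_ring A) (center_module A)"
  unfolding essential_over_center_iff[OF annihilator_of_two_submodule]
proof (intro ballI impI)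
  fix a assume a: "a \<in> carrier A" "a \<noteq> \<zero>"
  let ?U = "{1..n - 1}"
  have U: "?U \<subseteq> top" "odd (card ?U)" "?U \<noteq> top" "top - ?U = {n}" using n by auto
  let ?x = "monomial A a ?U"
  have x: "?x \<in> carrier E" using a U by (intro monomial_closed_E)
  have "?x \<noteq> \<zero>\<^bsub>E\<^esub>" using a E_nonzero_iff[of ?x] monomial_apply by metis
  then obtain z where z: "z \<in> center_set E" "?x \<otimes>\<^bsub>E\<^esub> z \<noteq> \<zero>\<^bsub>E\<^esub>" "?x \<otimes>\<^bsub>E\<^esub> z \<in> center_set E"
    using ess x L.centrally_essential_iff by blast
  note zE = center_set_closed[OF z(1)]
  have app: "(?x \<otimes>\<^bsub>E\<^esub> z) S = (if ?U \<subseteq> S then exterior_sign A ?U (S - ?U) (a \<otimes> z (S - ?U)) else \<zero>)" for S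
    using monomial_mult_apply[OF zE a(1) U(1)] .
  have zc: "z V \<in> center_set A" for V using z(1) by (simp add: central_iff)
  note zA = center_set_closed[OF zc]
  obtain S where S: "(?x \<otimes>\<^bsub>E\<^esub> z) S \<noteq> \<zero>" using z(2) E_nonzero_iff by blast
  then have sub: "S \<subseteq> top" "?U \<subseteq> S"
    using outside[OF L.m_closed[OF x zE]] app by (blast, metis)
  have nz: "a \<otimes> z (S - ?U) \<noteq> \<zero>" using S sub app by (auto simp: sign_zero)
  have "S - ?U \<subseteq> {n}" using sub U(4) by blast
  then consider "S - ?U = {}" | "S - ?U = {n}" by blast
  then have "a \<otimes> z (S - ?U) \<oplus> a \<otimes> z (S - ?U) = \<zero>"
  proof cases
    case 1
    then have "S = ?U" using sub by blast
    then have "(?x \<otimes>\<^bsub>E\<^esub> z) S = a \<otimes> z {}" using app by (simp add: exterior_sign_def)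
    moreover have "(?x \<otimes>\<^bsub>E\<^esub> z) S \<oplus> (?x \<otimes>\<^bsub>E\<^esub> z) S = \<zero>"
      using z(3) U \<open>S = ?U\<close> unfolding central_iff by metis
    ultimately show ?thesis unfolding 1 by simp
  next
    case 2
    have "{n} \<noteq> top" using n U by (metis One_nat_def atLeastAtMost_singleton_iff card_atLeastAtMost
      card.empty card_insert_disjoint diff_Suc_1 empty_iff finite.emptyI odd_one)
    then have "z {n} \<oplus> z {n} = \<zero>" using z(1) by (simp add: central_iff)
    then show ?thesis
      unfolding 2 using a zA[of "{n}"] r_distr[of "z {n}" "z {n}" a] by simp
  qed
  then show "\<exists>c\<in>center_set A. a \<otimes> c \<noteq> \<zero> \<and> a \<otimes> c \<in> annihilator_of_two A"
    using nz zc zA a unfolding annihilator_of_two_eq by blast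
qed

lemma E_centrally_essentialI:
  assumes ess: "centrally_essential A"
    and alt: "essential_submodule (annihilator_of_two A) (center_ring A) (center_module A) \<or> odd n"
  shows "centrally_essential E"
  unfolding L.centrally_essential_iff
proof (intro ballI impI)
  fix f assume f: "f \<in> carrier E" "f \<noteq> \<zero>\<^bsub>E\<^esub>"
  obtain c where c: "c \<in> center_set A" "f \<otimes>\<^bsub>E\<^esub> monomial A c {} \<noteq> \<zero>\<^bsub>E\<^esub>" "\<And>S. f S \<otimes> c \<in> center_set A"
    using scale_coefficients_into[OF ess[unfolded centrally_essential_def] f] by blast
  note cA = center_set_closed[OF c(1)]
  define g where "g = f \<otimes>\<^bsub>E\<^esub> monomial A c {}"
  have g: "g \<in> carrier E" "g \<noteq> \<zero>\<^bsub>E\<^esub>" using f c cA by (simp_all add: g_def monomial_closed_E)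
  have gc: "g S \<in> center_set A" for S
    unfolding g_def mult_scalar_apply[OF f(1) cA] by (rule c(3))
  have "\<exists>z\<in>center_set E. g \<otimes>\<^bsub>E\<^esub> z \<noteq> \<zero>\<^bsub>E\<^esub> \<and> g \<otimes>\<^bsub>E\<^esub> z \<in> center_set E"
    using alt
  proof
    assume "odd n"
    then show ?thesis using g gc by (rule central_multiple_of_central_coefficients)
  next
    assume two: "essential_submodule (annihilator_of_two A) (center_ring A) (center_module A)"
    obtain d where d: "d \<in> center_set A" "g \<otimes>\<^bsub>E\<^esub> monomial A d {} \<noteq> \<zero>\<^bsub>E\<^esub>"
      "\<And>S. g S \<otimes> d \<in> annihilator_of_two A"
      using scale_coefficients_into[OF two g] by blast
    note dA = center_set_closed[OF d(1)]
    have "g \<otimes>\<^bsub>E\<^esub> monomial A d {} \<in> center_set E"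
      using d(3) g dA center_set_mult[OF gc d(1)]
      by (auto simp: central_iff monomial_closed_E mult_scalar_apply annihilator_of_two_eq)
    then show ?thesis using d scalar_central by blast
  qed
  then obtain z where z: "z \<in> center_set E" "g \<otimes>\<^bsub>E\<^esub> z \<noteq> \<zero>\<^bsub>E\<^esub>" "g \<otimes>\<^bsub>E\<^esub> z \<in> center_set E" by blast
  have "g \<otimes>\<^bsub>E\<^esub> z = f \<otimes>\<^bsub>E\<^esub> (monomial A c {} \<otimes>\<^bsub>E\<^esub> z)"
    unfolding g_def using f cA center_set_closed[OF z(1)] by (simp add: L.m_assoc monomial_closed_E)
  moreover have "monomial A c {} \<otimes>\<^bsub>E\<^esub> z \<in> center_set E"
    using scalar_central[OF c(1)] z(1) by (rule L.center_set_mult)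
  ultimately show "\<exists>z\<in>center_set E. f \<otimes>\<^bsub>E\<^esub> z \<noteq> \<zero>\<^bsub>E\<^esub> \<and> f \<otimes>\<^bsub>E\<^esub> z \<in> center_set E"
    using z by metis
qed

theorem E_centrally_essential_iff:
  assumes "n \<ge> 1"
  shows "centrally_essential E \<longleftrightarrow> centrally_essential A \<and>
    (essential_submodule (annihilator_of_two A) (center_ring A) (center_module A) \<or> odd n)"
  using assms E_centrally_essential_imp_base E_centrally_essential_imp_annihilator E_centrally_essentialI
  by blast

end

section \<open>Quotients by generated ideals\<close>

text \<open>Closure under sums is all that is required below: the generating sets are closed under
negation, as they contain all multiples by elements of the center.\<close>

inductive_set additive_span :: "('a, 'm) ring_scheme \<Rightarrow> 'a set \<Rightarrow> 'a set"
  for R :: "('a, 'm) ring_scheme" and X :: "'a set"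
  where
    zero: "\<zero>\<^bsub>R\<^esub> \<in> additive_span R X"
  | gen: "x \<in> X \<Longrightarrow> x \<in> additive_span R X"
  | add: "x \<in> additive_span R X \<Longrightarrow> y \<in> additive_span R X \<Longrightarrow> x \<oplus>\<^bsub>R\<^esub> y \<in> additive_span R X"

lemma (in ring) additive_span_closed:
  assumes "X \<subseteq> carrier R" "x \<in> additive_span R X"
  shows "x \<in> carrier R"
  using assms(2,1) by induction auto

lemma (in ring) additive_span_mult:
  assumes X: "X \<subseteq> carrier R" and Y: "Y \<subseteq> carrier R"
    and XY: "\<And>x y. x \<in> X \<Longrightarrow> y \<in> Y \<Longrightarrow> x \<otimes> y \<in> additive_span R Z"
    and x: "x \<in> additive_span R X" and y: "y \<in> additive_span R Y"
  shows "x \<otimes> y \<in> additive_span R Z"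
  using x
proof induction
  case zero
  then show ?case using additive_span_closed[OF Y y] by (simp add: additive_span.zero)
next
  case (gen x)
  note x = gen subsetD[OF X gen]
  from y show ?case
  proof induction
    case zero
    then show ?case using x(2) by (simp add: additive_span.zero)
  next
    case (gen y)
    then show ?case using XY x by blast
  next
    case (add y z)
    then show ?case
      using additive_span_closed[OF Y add(1)] additive_span_closed[OF Y add(2)] x(2)
      by (simp add: r_distr additive_span.add)
  qed
next
  case (add x z)
  then show ?case
    using additive_span_closed[OF X add(1)] additive_span_closed[OF X add(2)] additive_span_closed[OF Y y]
    by (simp add: l_distr additive_span.add)
qed

context ideal
begin

lemma quotient_carrier: "carrier (R Quot I) = (+>) I ` carrier R"
  by (auto simp: FactRing_def A_RCOSETS_def')

lemma quotient_zero_iff: "x \<in> carrier R \<Longrightarrow> I +> x = \<zero>\<^bsub>R Quot I\<^esub> \<longleftrightarrow> x \<in> I"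
  using rcos_const_imp_mem a_rcos_zero[OF ideal_axioms] by (auto simp: FactRing_def)

lemma quotient_eqI:
  assumes "x \<ominus> y \<in> I" "x \<in> carrier R" "y \<in> carrier R"
  shows "I +> x = I +> y"
  using assms quotient_eq_iff_same_a_r_cos[OF ideal_axioms] by blast

text \<open>The scalar action on a quotient algebra is defined as a union over representatives. If scalars
act by multiplication with ring elements, all members of that union agree.\<close>

lemma quotient_smult:
  assumes k: "k \<in> carrier R" and x: "x \<in> carrier R"
    and s: "\<And>y. y \<in> carrier R \<Longrightarrow> s y = k \<otimes> y"
  shows "(\<Union>y\<in>I +> x. I +> s y) = I +> s x"
proof -
  have "I +> s y = I +> s x" if "y \<in> I +> x" for y
  proof -
    obtain i where i: "i \<in> I" "y = i \<oplus> x" using \<open>y \<in> I +> x\<close> by (auto simp: a_r_coset_def')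
    note iR = Icarr[OF i(1)]
    have "s y \<ominus> s x = k \<otimes> i"
      using i iR x k by (simp add: s r_distr a_minus_def a_assoc r_neg)
    then show ?thesis
      using i iR x k by (intro quotient_eqI) (auto simp: s I_l_closed)
  qed
  moreover have "x \<in> I +> x" using x by (rule a_rcos_self)
  ultimately show ?thesis by blast
qed

end

text \<open>A map on cosets via an arbitrary representative; it is meaningful for maps that are constant on
cosets.\<close>

definition induced :: "('a \<Rightarrow> 'b) \<Rightarrow> 'a set \<Rightarrow> 'b"
  where "induced h X = h (SOME x. x \<in> X)"

lemma (in ring_hom_ring) induced_coset:
  assumes "ideal I R" "I \<subseteq> a_kernel R S h" "x \<in> carrier R"
  shows "induced h (I +> x) = h x"
proof -
  interpret I: ideal I R by fact
  have "x \<in> I +> x" using assms(3) by (rule I.a_rcos_self)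
  then have "(SOME y. y \<in> I +> x) \<in> I +> x" by (rule someI)
  moreover have "h y = h x" if y: "y \<in> I +> x" for y
  proof -
    obtain i where i: "i \<in> I" "y = i \<oplus> x" using y by (auto simp: a_r_coset_def')
    have "i \<in> a_kernel R S h" using i(1) assms(2) by blast
    then show ?thesis using i(2) assms(3) I.Icarr[OF i(1)] by simp
  qed
  ultimately show ?thesis by (simp add: induced_def)
qed

section \<open>From words to the standard basis\<close>

lemma (in ring) cring_center_ring: "cring (center_ring R)"
  using subcring_iff[OF subsetI[OF center_set_closed[of _ R]]] center_subcring by (simp add: center_ring_def)

lemma center_ring_simps [simp]:
  "carrier (center_ring A) = center_set A" "\<zero>\<^bsub>center_ring A\<^esub> = \<zero>\<^bsub>A\<^esub>" "\<one>\<^bsub>center_ring A\<^esub> = \<one>\<^bsub>A\<^esub>"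
  "x \<otimes>\<^bsub>center_ring A\<^esub> y = x \<otimes>\<^bsub>A\<^esub> y" "x \<oplus>\<^bsub>center_ring A\<^esub> y = x \<oplus>\<^bsub>A\<^esub> y"
  by (simp_all add: center_ring_def)

lemma monoid_word_monoid: "monoid (word_monoid X)"
  by (rule monoidI) (auto simp: word_monoid_def)

lemma word_monoid_simps [simp]:
  "carrier (word_monoid X) = lists X" "u \<otimes>\<^bsub>word_monoid X\<^esub> v = u @ v" "\<one>\<^bsub>word_monoid X\<^esub> = []"
  by (simp_all add: word_monoid_def)

context exterior
begin

text \<open>\<open>W1\<close> is the free \<open>C\<close>-algebra on the set \<open>F = C\<^sup>n\<close>, of which the exterior algebra of \<open>F\<close> is a quotient.\<close>

abbreviation C where "C \<equiv> center_ring A"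
abbreviation F where "F \<equiv> free_module C n"
abbreviation W where "W \<equiv> word_monoid (carrier F)"
abbreviation W1 where "W1 \<equiv> monoid_algebra C W"

definition vec :: "(nat \<Rightarrow> 'a) \<Rightarrow> nat set \<Rightarrow> 'a"
  where "vec v = (\<lambda>S. if \<exists>i\<in>top. S = {i} then v (the_elem S) else \<zero>)"

definition word_product :: "(nat \<Rightarrow> 'a) list \<Rightarrow> nat set \<Rightarrow> 'a"
  where "word_product w = foldr (\<lambda>v x. vec v \<otimes>\<^bsub>E\<^esub> x) w \<one>\<^bsub>E\<^esub>"

text \<open>Degree one with central coefficients: without centrality the square of \<open>a e\<^sub>1 + b e\<^sub>2\<close> would be
\<open>(a b - b a) e\<^sub>1 e\<^sub>2\<close>.\<close>

definition degree_one :: "(nat set \<Rightarrow> 'a) set"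
  where "degree_one = {f \<in> carrier E. \<forall>S. f S \<in> center_set A \<and> (f S \<noteq> \<zero> \<longrightarrow> (\<exists>i\<in>top. S = {i}))}"

lemma E_carrierI:
  assumes "\<And>S. f S \<in> carrier A" "\<And>S. \<not> S \<subseteq> top \<Longrightarrow> f S = \<zero>"
  shows "f \<in> carrier E"
  unfolding exterior_model_eq
proof (rule E.carrierI)
  have "{S. f S \<noteq> \<zero>} \<subseteq> Pow top" using assms(2) by blast
  then show "finite {S. f S \<noteq> \<zero>}" by (rule finite_subset) simp
qed (use assms in \<open>auto simp: subset_monoid_def\<close>)

lemma vec_other: "(\<And>i. i \<in> top \<Longrightarrow> S \<noteq> {i}) \<Longrightarrow> vec v S = \<zero>"
  by (auto simp: vec_def)

lemma F_coeff: "v \<in> carrier F \<Longrightarrow> i \<in> top \<Longrightarrow> v i \<in> center_set A"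
  by (auto simp: free_module_def)

lemma vec_center: "v \<in> carrier F \<Longrightarrow> vec v S \<in> center_set A"
  using F_coeff center_set_zero by (cases "\<exists>i\<in>top. S = {i}") (auto simp: vec_def)

lemma vec_degree_one:
  assumes v: "v \<in> carrier F"
  shows "vec v \<in> degree_one"
proof -
  have "vec v \<in> carrier E"
    by (rule E_carrierI) (use center_set_closed[OF vec_center[OF v]] in \<open>auto simp: vec_def\<close>)
  then show ?thesis
    using vec_center[OF v] vec_other[of _ v] unfolding degree_one_def by blast
qed

lemma vec_closed: "v \<in> carrier F \<Longrightarrow> vec v \<in> carrier E"
  using vec_degree_one by (simp add: degree_one_def)

lemma F_add: "v \<oplus>\<^bsub>F\<^esub> w = (\<lambda>i\<in>top. v i \<oplus> w i)"
  and F_smult: "c \<odot>\<^bsub>F\<^esub> v = (\<lambda>i\<in>top. c \<otimes> v i)"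
  by (simp_all add: free_module_def)

lemma F_add_closed: "\<lbrakk>v \<in> carrier F; w \<in> carrier F\<rbrakk> \<Longrightarrow> v \<oplus>\<^bsub>F\<^esub> w \<in> carrier F"
  unfolding F_add by (auto simp: free_module_def intro!: center_set_add)

lemma F_smult_closed: "\<lbrakk>c \<in> center_set A; v \<in> carrier F\<rbrakk> \<Longrightarrow> c \<odot>\<^bsub>F\<^esub> v \<in> carrier F"
  unfolding F_smult by (auto simp: free_module_def intro!: center_set_mult)

lemma vec_add: "\<lbrakk>v \<in> carrier F; w \<in> carrier F\<rbrakk> \<Longrightarrow> vec (v \<oplus>\<^bsub>F\<^esub> w) = vec v \<oplus>\<^bsub>E\<^esub> vec w"
  unfolding fun_eq_iff E_add F_add by (auto simp: vec_def)

lemma vec_smult: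
  assumes c: "c \<in> center_set A" and v: "v \<in> carrier F"
  shows "vec (c \<odot>\<^bsub>F\<^esub> v) = monomial A c {} \<otimes>\<^bsub>E\<^esub> vec v"
proof
  fix S
  have "(monomial A c {} \<otimes>\<^bsub>E\<^esub> vec v) S = c \<otimes> vec v S"
    using center_set_closed[OF c] coeff[OF vec_closed[OF v]]
    by (simp add: monomial_mult_apply vec_closed v exterior_sign_def)
  also have "\<dots> = vec (c \<odot>\<^bsub>F\<^esub> v) S"
    using center_set_closed[OF c] unfolding F_smult by (auto simp: vec_def)
  finally show "vec (c \<odot>\<^bsub>F\<^esub> v) S = (monomial A c {} \<otimes>\<^bsub>E\<^esub> vec v) S" ..
qed

lemma monomial_minus: "\<lbrakk>a \<in> carrier A; S \<subseteq> top\<rbrakk> \<Longrightarrow> monomial A (\<ominus> a) S = \<ominus>\<^bsub>E\<^esub> monomial A a S"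
  using monomial_add_E[of "\<ominus> a" a S] by (intro L.minus_equality[symmetric]) (simp_all add: l_neg monomial_closed_E monomial_zero_E)

lemma degree_one_monomial: "\<lbrakk>f \<in> degree_one; f U \<noteq> \<zero>\<rbrakk> \<Longrightarrow> monomial A (f U) U \<in> degree_one"
  using center_set_zero
  by (auto simp: degree_one_def monomial_def intro!: monomial_closed_E[unfolded monomial_def] coeff)

lemma degree_one_add:
  assumes f: "f \<in> degree_one" and g: "g \<in> degree_one"
  shows "f \<oplus>\<^bsub>E\<^esub> g \<in> degree_one"
proof -
  have "\<exists>i\<in>top. S = {i}" if "f S \<oplus> g S \<noteq> \<zero>" for S
  proof (cases "f S = \<zero>")
    case True
    then have "g S \<noteq> \<zero>" using that by auto
    then show ?thesis using g by (simp add: degree_one_def)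
  next
    case False
    then show ?thesis using f by (simp add: degree_one_def)
  qed
  note supp = this
  show ?thesis
    unfolding degree_one_def mem_Collect_eq
  proof (intro conjI allI impI)
    show "f \<oplus>\<^bsub>E\<^esub> g \<in> carrier E" using f g by (simp add: degree_one_def)
    fix S
    show "(f \<oplus>\<^bsub>E\<^esub> g) S \<in> center_set A"
      unfolding E_add using f g by (intro center_set_add) (simp_all add: degree_one_def)
    assume "(f \<oplus>\<^bsub>E\<^esub> g) S \<noteq> \<zero>"
    then show "\<exists>i\<in>top. S = {i}" unfolding E_add by (rule supp)
  qed
qed

lemma degree_one_anticommute:
  assumes f: "f \<in> degree_one" and g: "g \<in> degree_one"
  shows "f \<otimes>\<^bsub>E\<^esub> g = \<ominus>\<^bsub>E\<^esub> (g \<otimes>\<^bsub>E\<^esub> f)"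
proof -
  have fE: "f \<in> carrier E" and gE: "g \<in> carrier E" using f g by (simp_all add: degree_one_def)
  from fE show ?thesis
  proof (induction f rule: E_induct)
    case zero
    then show ?case using gE by simp
  next
    case (add h h')
    then show ?case using gE by (simp add: L.l_distr L.r_distr L.minus_add)
  next
    case (mono U)
    then obtain i where i: "i \<in> top" "U = {i}" using f by (auto simp: degree_one_def)
    have m: "monomial A (f U) U \<in> carrier E" using i coeff[OF fE] by (simp add: monomial_closed_E)
    from gE show ?case
    proof (induction g rule: E_induct)
      case zero
      then show ?case using m by simp
    next
      case (add h h')
      then show ?case using m by (simp add: L.l_distr L.r_distr L.minus_add)
    next
      case (mono V)
      then obtain j where j: "j \<in> top" "V = {j}" using g by (auto simp: degree_one_def)
      have comm: "f U \<otimes> g V = g V \<otimes> f U"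
        using f center_set_commute[of "f U" A] coeff[OF gE] by (simp add: degree_one_def)
      have carr: "g V \<otimes> f U \<in> carrier A" using coeff[OF fE] coeff[OF gE] by simp
      have "exterior_sign A U V (g V \<otimes> f U) = \<ominus> exterior_sign A V U (g V \<otimes> f U)"
      proof (cases "i = j")
        case False
        then have "inversions U V + inversions V U = 1" using inversions_swap[of U V] i j by simp
        then have "even (inversions U V) \<longleftrightarrow> odd (inversions V U)" by (metis even_add odd_one)
        then show ?thesis using False i j carr by (auto simp: exterior_sign_def)
      qed (auto simp: exterior_sign_def i j)
      then show ?case
        using i j coeff[OF fE] coeff[OF gE] carr
        by (simp add: monomial_mult comm[unfolded i j] insert_commute sign_closed monomial_minus[symmetric])
    qed
  qed
qed

text \<open>Since \<open>2\<close> may be a zero divisor, this does not follow from anticommutation of \<open>f\<close> with itself. In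
an expansion into monomials, however, the squares vanish and the cross terms cancel in pairs.\<close>

lemma degree_one_square:
  assumes "f \<in> degree_one"
  shows "f \<otimes>\<^bsub>E\<^esub> f = \<zero>\<^bsub>E\<^esub>"
proof -
  have "f \<in> carrier E" using assms by (simp add: degree_one_def)
  then have "f \<in> degree_one \<and> f \<otimes>\<^bsub>E\<^esub> f = \<zero>\<^bsub>E\<^esub>"
  proof (induction f rule: E_induct)
    case zero
    have "\<zero>\<^bsub>E\<^esub> \<in> degree_one"
      using center_set_zero L.zero_closed unfolding degree_one_def mem_Collect_eq E_zero[of _] by blast
    then show ?case by simp
  next
    case (mono U)
    then obtain i where i: "i \<in> top" "U = {i}" using assms by (auto simp: degree_one_def)
    have "f U \<in> carrier A" using assms by (auto simp: degree_one_def intro: coeff)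
    moreover have "exterior_sign A U U x = \<zero>" for x using i by (simp add: exterior_sign_def)
    ultimately show ?case
      using mono degree_one_monomial[OF assms] i by (simp add: monomial_mult monomial_zero_E)
  next
    case (add g h)
    then have c: "g \<in> carrier E" "h \<in> carrier E" by (simp_all add: degree_one_def)
    have "(g \<oplus>\<^bsub>E\<^esub> h) \<otimes>\<^bsub>E\<^esub> (g \<oplus>\<^bsub>E\<^esub> h) = h \<otimes>\<^bsub>E\<^esub> g \<oplus>\<^bsub>E\<^esub> g \<otimes>\<^bsub>E\<^esub> h"
      using c add by (simp add: L.l_distr L.r_distr)
    also have "\<dots> = \<zero>\<^bsub>E\<^esub>"
      using degree_one_anticommute[of g h] add c by (simp add: L.r_neg)
    finally show ?case using degree_one_add add by simp
  qed
  then show ?thesis ..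
qed

lemma word_product_closed: "w \<in> lists (carrier F) \<Longrightarrow> word_product w \<in> carrier E"
  by (induction w) (auto simp: word_product_def vec_closed)

lemma word_product_append:
  assumes "u \<in> lists (carrier F)" "v \<in> lists (carrier F)"
  shows "word_product (u @ v) = word_product u \<otimes>\<^bsub>E\<^esub> word_product v"
  using assms
proof (induction u)
  case Nil
  then show ?case using word_product_closed[of v] by (simp add: word_product_def)
next
  case (Cons x u)
  have "word_product (y # z) = vec y \<otimes>\<^bsub>E\<^esub> word_product z" for y z by (simp add: word_product_def)
  then show ?case
    using Cons word_product_closed[of u] word_product_closed[of v]
    by (simp add: vec_closed L.m_assoc)
qed

lemma center_coeffs_commute:
  assumes f: "f \<in> carrier E" "\<And>S. f S \<in> center_set A" and a: "a \<in> carrier A"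
  shows "monomial A a {} \<otimes>\<^bsub>E\<^esub> f = f \<otimes>\<^bsub>E\<^esub> monomial A a {}"
proof
  fix S
  show "(monomial A a {} \<otimes>\<^bsub>E\<^esub> f) S = (f \<otimes>\<^bsub>E\<^esub> monomial A a {}) S"
    using f(1) a coeff[OF f(1)] center_set_commute[OF f(2) a, of S]
    by (simp add: monomial_mult_apply mult_monomial_apply exterior_sign_def)
qed

lemma word_product_commute:
  assumes "w \<in> lists (carrier F)" and a: "a \<in> carrier A"
  shows "monomial A a {} \<otimes>\<^bsub>E\<^esub> word_product w = word_product w \<otimes>\<^bsub>E\<^esub> monomial A a {}"
  using assms(1)
proof (induction w)
  case Nil
  then show ?case using a by (simp add: word_product_def monomial_closed_E)
next
  case (Cons v w)
  have m: "monomial A a {} \<in> carrier E" using a by (simp add: monomial_closed_E)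
  have v: "vec v \<in> carrier E" and w: "word_product w \<in> carrier E"
    using Cons.hyps by (simp_all add: vec_closed word_product_closed)
  have "monomial A a {} \<otimes>\<^bsub>E\<^esub> (vec v \<otimes>\<^bsub>E\<^esub> word_product w) = (vec v \<otimes>\<^bsub>E\<^esub> monomial A a {}) \<otimes>\<^bsub>E\<^esub> word_product w"
    using m v w center_coeffs_commute[OF v vec_center a] Cons.hyps by (simp add: L.m_assoc[symmetric])
  also have "\<dots> = (vec v \<otimes>\<^bsub>E\<^esub> word_product w) \<otimes>\<^bsub>E\<^esub> monomial A a {}"
    using m v w Cons.IH by (simp add: L.m_assoc)
  finally show ?case by (simp add: word_product_def)
qed

text \<open>The homomorphism goes directly to the exterior algebra over \<open>A\<close>, not to the one over \<open>C\<close>, so that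
the comparison with \<open>A \<otimes> \<Lambda>(C\<^sup>n)\<close> takes place in a single ring.\<close>

sublocale \<phi>: monoid_algebra_map C W E "\<lambda>c. monomial A c {}" word_product
proof (intro monoid_algebra_map.intro monoid_algebra_map_axioms.intro)
  show "ring C" using cring_center_ring by (rule cring.axioms)
  show "monoid W" by (rule monoid_word_monoid)
  show "ring E" by (rule L.ring_axioms)
  show "(\<lambda>c. monomial A c {}) \<in> ring_hom C E"
    by (rule ring_hom_memI)
      (auto dest!: center_set_closed simp: monomial_closed_E monomial_mult exterior_sign_def monomial_add_E E_one)
  show "word_product \<one>\<^bsub>W\<^esub> = \<one>\<^bsub>E\<^esub>" by (simp add: word_product_def)
qed (auto simp: word_product_closed word_product_append word_product_commute center_set_closed)

abbreviation \<phi> where "\<phi> \<equiv> linear_extension C E (\<lambda>c. monomial A c {}) word_product"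

lemma W1_eq: "twisted_algebra C W (\<lambda>_ _ x. x) = W1"
  by (simp add: monoid_algebra_eq_twisted)

lemmas W1_induct = \<phi>.monomial_induct[unfolded W1_eq, consumes 1, case_names zero mono add]
lemmas W1_monomial = \<phi>.monomial_closed[unfolded W1_eq, simplified]
lemmas W1_mult = \<phi>.monomial_mult_monomial[unfolded W1_eq, simplified]
lemmas W1_sum = \<phi>.monomial_add[unfolded W1_eq, simplified]
lemmas W1_zero = \<phi>.monomial_zero[unfolded W1_eq, simplified]
lemmas W1_smult = \<phi>.smult_monomial[unfolded W1_eq, simplified]
lemmas \<phi>_monomial = \<phi>.extend_monomial[simplified]

sublocale W1: ring W1
  using \<phi>.ring_twisted unfolding W1_eq .

sublocale \<phi>h: ring_hom_ring W1 E \<phi>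
  by (rule ring_hom_ringI2[OF W1.ring_axioms L.ring_axioms \<phi>.extend_hom])

end

section \<open>The exterior algebra of a free module is spanned by increasing words\<close>

context exterior
begin

text \<open>\<open>Q1\<close> has the ring structure of the exterior algebra of \<open>F\<close>, \<open>q1\<close> is the projection onto it, and
\<open>word c w\<close> is the word \<open>w\<close> with the coefficient \<open>c\<close>.\<close>

abbreviation ext_ideal where "ext_ideal \<equiv> Idl\<^bsub>W1\<^esub> (exterior_relations C F)"
abbreviation Q1 where "Q1 \<equiv> W1 Quot ext_ideal"
abbreviation q1 where "q1 \<equiv> (\<lambda>x. ext_ideal +>\<^bsub>W1\<^esub> x)"
abbreviation word where "word c w \<equiv> monomial C c w"

lemma one_center: "\<one> \<in> center_set A" by (rule center_set_one)

lemma gen_closed: "v \<in> carrier F \<Longrightarrow> word \<one> [v] \<in> carrier W1"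
  by (simp add: W1_monomial one_center)

lemma exterior_relations_cases:
  assumes "r \<in> exterior_relations C F"
  obtains v w where "v \<in> carrier F" "w \<in> carrier F"
      "r = word \<one> [v \<oplus>\<^bsub>F\<^esub> w] \<ominus>\<^bsub>W1\<^esub> (word \<one> [v] \<oplus>\<^bsub>W1\<^esub> word \<one> [w])"
    | c v where "c \<in> center_set A" "v \<in> carrier F"
      "r = word \<one> [c \<odot>\<^bsub>F\<^esub> v] \<ominus>\<^bsub>W1\<^esub> (c \<odot>\<^bsub>W1\<^esub> word \<one> [v])"
    | v where "v \<in> carrier F" "r = word \<one> [v] \<otimes>\<^bsub>W1\<^esub> word \<one> [v]"
  using assms by (auto simp: exterior_relations_def Let_def basis_elt_eq_monomial)

lemma exterior_relations_intros:
  "v \<in> carrier F \<Longrightarrow> w \<in> carrier F \<Longrightarrow>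
    word \<one> [v \<oplus>\<^bsub>F\<^esub> w] \<ominus>\<^bsub>W1\<^esub> (word \<one> [v] \<oplus>\<^bsub>W1\<^esub> word \<one> [w]) \<in> exterior_relations C F"
  "c \<in> center_set A \<Longrightarrow> v \<in> carrier F \<Longrightarrow>
    word \<one> [c \<odot>\<^bsub>F\<^esub> v] \<ominus>\<^bsub>W1\<^esub> (c \<odot>\<^bsub>W1\<^esub> word \<one> [v]) \<in> exterior_relations C F"
  "v \<in> carrier F \<Longrightarrow> word \<one> [v] \<otimes>\<^bsub>W1\<^esub> word \<one> [v] \<in> exterior_relations C F"
  unfolding exterior_relations_def Let_def basis_elt_eq_monomial center_ring_simps by blast+

lemma word_smult: "\<lbrakk>c \<in> center_set A; d \<in> center_set A\<rbrakk> \<Longrightarrow> c \<odot>\<^bsub>W1\<^esub> word d w = word (c \<otimes> d) w"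
  by (rule W1_smult)

lemma word_mult: "\<lbrakk>c \<in> center_set A; d \<in> center_set A; u \<in> lists (carrier F); v \<in> lists (carrier F)\<rbrakk> \<Longrightarrow>
    word c u \<otimes>\<^bsub>W1\<^esub> word d v = word (c \<otimes> d) (u @ v)"
  by (rule W1_mult)

lemma center_right_one: "c \<in> center_set A \<Longrightarrow> c \<otimes> \<one> = c" "c \<in> center_set A \<Longrightarrow> \<one> \<otimes> c = c"
  by (auto dest: center_set_closed)

lemma exterior_relations_closed: "exterior_relations C F \<subseteq> carrier W1"
proof
  fix r assume "r \<in> exterior_relations C F"
  then show "r \<in> carrier W1"
    by (cases rule: exterior_relations_cases)
      (auto simp: gen_closed F_add_closed F_smult_closed word_smult one_center center_right_one W1_monomial)
qed

lemma \<phi>_gen: "v \<in> carrier F \<Longrightarrow> \<phi> (word \<one> [v]) = vec v"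
  using \<phi>_monomial[of \<one> "[v]"] by (simp add: one_center word_product_def vec_closed E_one[symmetric])

lemma exterior_relations_kernel: "exterior_relations C F \<subseteq> a_kernel W1 E \<phi>"
proof
  fix r assume r: "r \<in> exterior_relations C F"
  then have "\<phi> r = \<zero>\<^bsub>E\<^esub>"
  proof (cases rule: exterior_relations_cases)
    case (1 v w)
    then show ?thesis
      by (simp add: W1.minus_eq gen_closed F_add_closed \<phi>_gen vec_add vec_closed L.r_neg)
  next
    case (2 c v)
    have "\<phi> (word c [v]) = monomial A c {} \<otimes>\<^bsub>E\<^esub> vec v"
      using 2 \<phi>_monomial[of c "[v]"] by (simp add: word_product_def vec_closed)
    then show ?thesis
      using 2 by (simp add: W1.minus_eq gen_closed F_smult_closed \<phi>_gen vec_smult vec_closed L.r_neg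
        word_smult one_center center_right_one W1_monomial monomial_closed_E center_set_closed)
  next
    case (3 v)
    then show ?thesis by (simp add: gen_closed \<phi>_gen degree_one_square vec_degree_one)
  qed
  then show "r \<in> a_kernel W1 E \<phi>"
    unfolding a_kernel_def' using subsetD[OF exterior_relations_closed r] by blast
qed

sublocale I1: ideal ext_ideal W1
  using exterior_relations_closed by (rule W1.genideal_ideal)

sublocale Q1h: ring_hom_ring W1 Q1 q1
  by (rule I1.rcos_ring_hom_ring)

lemma q1_relation: "r \<in> exterior_relations C F \<Longrightarrow> q1 r = \<zero>\<^bsub>Q1\<^esub>"
  using exterior_relations_closed W1.genideal_self[OF exterior_relations_closed]
  by (subst I1.quotient_zero_iff) auto

lemma q1_add:
  assumes "v \<in> carrier F" "w \<in> carrier F"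
  shows "q1 (word \<one> [v \<oplus>\<^bsub>F\<^esub> w]) = q1 (word \<one> [v]) \<oplus>\<^bsub>Q1\<^esub> q1 (word \<one> [w])"
proof -
  have "q1 (word \<one> [v \<oplus>\<^bsub>F\<^esub> w]) = q1 (word \<one> [v] \<oplus>\<^bsub>W1\<^esub> word \<one> [w])"
    using exterior_relations_intros(1)[OF assms] W1.genideal_self[OF exterior_relations_closed] assms
    by (intro I1.quotient_eqI) (auto simp: gen_closed F_add_closed)
  then show ?thesis using assms by (simp add: gen_closed)
qed

lemma q1_smult:
  assumes "c \<in> center_set A" "v \<in> carrier F"
  shows "q1 (word \<one> [c \<odot>\<^bsub>F\<^esub> v]) = q1 (word c [v])"
proof -
  have "c \<odot>\<^bsub>W1\<^esub> word \<one> [v] = word c [v]"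
    using assms by (simp add: word_smult one_center center_right_one)
  then show ?thesis
    using exterior_relations_intros(2)[OF assms] W1.genideal_self[OF exterior_relations_closed] assms
    by (intro I1.quotient_eqI) (auto simp: gen_closed F_smult_closed W1_monomial)
qed

lemma q1_square: "v \<in> carrier F \<Longrightarrow> q1 (word \<one> [v]) \<otimes>\<^bsub>Q1\<^esub> q1 (word \<one> [v]) = \<zero>\<^bsub>Q1\<^esub>"
  using q1_relation[OF exterior_relations_intros(3)] by (simp add: gen_closed)

text \<open>Polarization of \<open>x\<^sup>2 = 0\<close> at \<open>x = v + w\<close>.\<close>

lemma q1_anticommute:
  assumes v: "v \<in> carrier F" and w: "w \<in> carrier F"
  shows "q1 (word \<one> [v]) \<otimes>\<^bsub>Q1\<^esub> q1 (word \<one> [w]) = \<ominus>\<^bsub>Q1\<^esub> (q1 (word \<one> [w]) \<otimes>\<^bsub>Q1\<^esub> q1 (word \<one> [v]))"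
proof -
  let ?v = "q1 (word \<one> [v])" and ?w = "q1 (word \<one> [w])"
  have c: "?v \<in> carrier Q1" "?w \<in> carrier Q1" using v w by (simp_all only: gen_closed Q1h.hom_closed)
  have "(?v \<oplus>\<^bsub>Q1\<^esub> ?w) \<otimes>\<^bsub>Q1\<^esub> (?v \<oplus>\<^bsub>Q1\<^esub> ?w) = \<zero>\<^bsub>Q1\<^esub>"
    using q1_square[OF F_add_closed[OF v w]] unfolding q1_add[OF v w] .
  moreover have "(?v \<oplus>\<^bsub>Q1\<^esub> ?w) \<otimes>\<^bsub>Q1\<^esub> (?v \<oplus>\<^bsub>Q1\<^esub> ?w) = ?v \<otimes>\<^bsub>Q1\<^esub> ?w \<oplus>\<^bsub>Q1\<^esub> ?w \<otimes>\<^bsub>Q1\<^esub> ?v"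
    using c q1_square[OF v] q1_square[OF w]
    by (simp add: Q1h.S.l_distr Q1h.S.r_distr Q1h.S.a_comm)
  ultimately have "?v \<otimes>\<^bsub>Q1\<^esub> ?w \<oplus>\<^bsub>Q1\<^esub> ?w \<otimes>\<^bsub>Q1\<^esub> ?v = \<zero>\<^bsub>Q1\<^esub>" by simp
  from Q1h.S.minus_equality[OF this] c show ?thesis by simp
qed

definition unit_vec :: "nat \<Rightarrow> nat \<Rightarrow> 'a"
  where "unit_vec i = (\<lambda>j\<in>top. if j = i then \<one> else \<zero>)"

lemma unit_vec_closed: "unit_vec i \<in> carrier F"
  using center_set_one center_set_zero by (auto simp: unit_vec_def free_module_def)

lemma unit_word: "map unit_vec xs \<in> lists (carrier F)"
  using unit_vec_closed by auto

lemma vec_unit: "i \<in> top \<Longrightarrow> vec (unit_vec i) = monomial A \<one> {i}"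
  by (auto simp: fun_eq_iff vec_def unit_vec_def monomial_def)

definition increasing :: "nat list set"
  where "increasing = {xs. sorted_wrt (<) xs \<and> set xs \<subseteq> top}"

text \<open>An increasing word has no inversions, so no sign appears.\<close>

lemma word_product_increasing: "xs \<in> increasing \<Longrightarrow> word_product (map unit_vec xs) = monomial A \<one> (set xs)"
proof (induction xs)
  case Nil
  then show ?case by (simp add: word_product_def E_one)
next
  case (Cons i xs)
  then have xs: "xs \<in> increasing" "i \<in> top" "\<forall>j\<in>set xs. i < j" "set xs \<subseteq> top"
    by (auto simp: increasing_def)
  have "{p \<in> {i} \<times> set xs. snd p < fst p} = {}" using xs(3) by auto
  then have "inversions {i} (set xs) = 0" unfolding inversions_def by (simp only: card.empty)
  moreover have "i \<notin> set xs" using xs(3) by auto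
  ultimately have "monomial A \<one> {i} \<otimes>\<^bsub>E\<^esub> monomial A \<one> (set xs) = monomial A \<one> (insert i (set xs))"
    using xs by (simp add: monomial_mult exterior_sign_def)
  then show ?case using Cons.IH[OF xs(1)] xs(2) by (simp add: word_product_def vec_unit)
qed

abbreviation basis_words where
  "basis_words \<equiv> {q1 (word c (map unit_vec xs)) | c xs. c \<in> center_set A \<and> xs \<in> increasing}"

lemma word_Cons:
  assumes "c \<in> center_set A" "d \<in> center_set A" "v \<in> carrier F" "w \<in> lists (carrier F)"
  shows "q1 (word c [v]) \<otimes>\<^bsub>Q1\<^esub> q1 (word d w) = q1 (word (c \<otimes> d) (v # w))"
  using Q1h.hom_mult[OF W1_monomial[of c "[v]"] W1_monomial[of d w]] assms by (simp add: word_mult)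

lemma q1_word_minus:
  assumes "c \<in> center_set A" "w \<in> lists (carrier F)"
  shows "q1 (word (\<ominus> c) w) = \<ominus>\<^bsub>Q1\<^esub> q1 (word c w)"
proof -
  note c = assms(1) center_set_minus[OF assms(1)] center_set_closed[OF assms(1)]
  have "word (\<ominus> c) w \<oplus>\<^bsub>W1\<^esub> word c w = \<zero>\<^bsub>W1\<^esub>"
    using W1_sum[of "\<ominus> c" c w] W1_zero c by (simp add: l_neg)
  then have "q1 (word (\<ominus> c) w) \<oplus>\<^bsub>Q1\<^esub> q1 (word c w) = \<zero>\<^bsub>Q1\<^esub>"
    using assms c Q1h.hom_add[OF W1_monomial[of "\<ominus> c" w] W1_monomial[of c w]] by simp
  then show ?thesis
    using assms c Q1h.hom_closed[OF W1_monomial] by (simp add: Q1h.S.minus_equality)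
qed

text \<open>One step of insertion sort: \<open>e\<^sub>i\<close> moves to the right past smaller generators, each time with a
change of sign, and gives \<open>0\<close> if it meets itself. In the last case the coefficient \<open>e\<close> is \<open>0\<close>, and
the word \<open>xs\<close> itself already has the required set of letters. That set is part of the statement
because the letter put in front of the sorted rest has to be smaller than all of its letters.\<close>

lemma insert_into_increasing:
  assumes "i \<in> top" "xs \<in> increasing" "d \<in> center_set A"
  shows "\<exists>e\<in>center_set A. \<exists>ys\<in>increasing. set ys = insert i (set xs) \<and>
    q1 (word d (unit_vec i # map unit_vec xs)) = q1 (word e (map unit_vec ys))"
  using assms(2,3)
proof (induction xs arbitrary: d)
  case Nil
  then show ?case using assms(1) by (intro bexI[of _ d] bexI[of _ "[i]"]) (auto simp: increasing_def)
next
  case (Cons a xs)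
  have xs: "xs \<in> increasing" "a \<in> top" "\<forall>j\<in>set xs. a < j"
    using Cons.prems(1) by (auto simp: increasing_def)
  note u = unit_vec_closed
  have uw: "map unit_vec xs \<in> lists (carrier F)" by (rule unit_word)
  have dA: "d \<in> carrier A" using Cons.prems(2) by (rule center_set_closed)
  have split: "q1 (word d (unit_vec j # unit_vec k # map unit_vec xs)) =
      (q1 (word \<one> [unit_vec j]) \<otimes>\<^bsub>Q1\<^esub> q1 (word \<one> [unit_vec k])) \<otimes>\<^bsub>Q1\<^esub> q1 (word d (map unit_vec xs))"
    if "d \<in> center_set A" for d j k
    using that u uw word_Cons[of \<one> d "unit_vec k" "map unit_vec xs"]
      word_Cons[of \<one> d "unit_vec j" "unit_vec k # map unit_vec xs"]
      Q1h.hom_closed[OF gen_closed[OF u]] Q1h.hom_closed[OF W1_monomial[OF that uw]]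
    by (simp add: one_center center_right_one Q1h.S.m_assoc)
  consider "i < a" | "i = a" | "a < i" by linarith
  then show ?case
  proof cases
    case 1
    then show ?thesis using assms(1) Cons.prems
      by (intro bexI[of _ d] bexI[of _ "i # a # xs"]) (auto simp: increasing_def)
  next
    case 2
    have "q1 (word d (unit_vec i # map unit_vec (a # xs))) = \<zero>\<^bsub>Q1\<^esub>"
      using split[OF Cons.prems(2), of i a] q1_square[OF u] Q1h.hom_closed[OF W1_monomial[OF Cons.prems(2) uw]] 2
      by simp
    moreover have "q1 (word \<zero> (map unit_vec (a # xs))) = \<zero>\<^bsub>Q1\<^esub>"
      using Q1h.hom_zero by (simp only: W1_zero)
    ultimately show ?thesis
      using 2 Cons.prems(1) center_set_zero by (intro bexI[of _ \<zero>] bexI[of _ "a # xs"]) auto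
  next
    case 3
    have md: "\<ominus> d \<in> center_set A" using Cons.prems(2) by (rule center_set_minus)
    have "q1 (word d (unit_vec i # map unit_vec (a # xs))) =
        q1 (word (\<ominus> d) (unit_vec a # unit_vec i # map unit_vec xs))"
    proof -
      let ?i = "q1 (word \<one> [unit_vec i])" and ?a = "q1 (word \<one> [unit_vec a])"
        and ?x = "q1 (word d (map unit_vec xs))"
      have c: "?i \<in> carrier Q1" "?a \<in> carrier Q1" "?x \<in> carrier Q1"
        using Q1h.hom_closed[OF gen_closed[OF u]] Q1h.hom_closed[OF W1_monomial[OF Cons.prems(2) uw]] by simp_all
      have "q1 (word d (unit_vec i # unit_vec a # map unit_vec xs)) = (?i \<otimes>\<^bsub>Q1\<^esub> ?a) \<otimes>\<^bsub>Q1\<^esub> ?x"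
        by (rule split[OF Cons.prems(2)])
      also have "\<dots> = \<ominus>\<^bsub>Q1\<^esub> ((?a \<otimes>\<^bsub>Q1\<^esub> ?i) \<otimes>\<^bsub>Q1\<^esub> ?x)"
        using c q1_anticommute[OF u u, of i a] by (simp add: Q1h.S.l_minus)
      also have "\<dots> = \<ominus>\<^bsub>Q1\<^esub> q1 (word d (unit_vec a # unit_vec i # map unit_vec xs))"
        using split[OF Cons.prems(2), of a i] by simp
      also have "\<dots> = q1 (word (\<ominus> d) (unit_vec a # unit_vec i # map unit_vec xs))"
        using q1_word_minus[OF Cons.prems(2), of "unit_vec a # unit_vec i # map unit_vec xs"] u uw by simp
      finally show ?thesis by simp
    qed
    also have "\<dots> = q1 (word \<one> [unit_vec a]) \<otimes>\<^bsub>Q1\<^esub> q1 (word (\<ominus> d) (unit_vec i # map unit_vec xs))"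
      using word_Cons[of \<one> "\<ominus> d" "unit_vec a" "unit_vec i # map unit_vec xs"] md u uw
      by (simp add: one_center center_right_one)
    finally have eq: "q1 (word d (unit_vec i # map unit_vec (a # xs))) =
      q1 (word \<one> [unit_vec a]) \<otimes>\<^bsub>Q1\<^esub> q1 (word (\<ominus> d) (unit_vec i # map unit_vec xs))" .
    obtain e ys where e: "e \<in> center_set A" "ys \<in> increasing" "set ys = insert i (set xs)"
      "q1 (word (\<ominus> d) (unit_vec i # map unit_vec xs)) = q1 (word e (map unit_vec ys))"
      using Cons.IH[OF xs(1) md] by blast
    have "q1 (word d (unit_vec i # map unit_vec (a # xs))) = q1 (word e (map unit_vec (a # ys)))"
      using eq e word_Cons[of \<one> e "unit_vec a" "map unit_vec ys"] u unit_word[of ys]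
      by (simp add: one_center center_right_one)
    moreover have "a # ys \<in> increasing" using e xs 3 by (auto simp: increasing_def)
    ultimately show ?thesis
      using e by (intro bexI[of _ e] bexI[of _ "a # ys"]) auto
  qed
qed

abbreviation unit_words where
  "unit_words \<equiv> {q1 (word c [unit_vec i]) | c i. c \<in> center_set A \<and> i \<in> top}"

lemma unit_words_closed: "unit_words \<subseteq> carrier Q1"
  using Q1h.hom_closed[OF W1_monomial] unit_vec_closed by auto

lemma basis_words_closed: "basis_words \<subseteq> carrier Q1"
  using Q1h.hom_closed[OF W1_monomial[OF _ unit_word]] by auto

text \<open>The relations only equate the generator of a sum or of a multiple with the corresponding
combination of two vectors at a time, so the expansion in the standard basis is reached by
adding one coordinate after another.\<close>

lemma vector_in_span:
  assumes v: "v \<in> carrier F"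
  shows "q1 (word \<one> [v]) \<in> additive_span Q1 unit_words"
proof -
  let ?r = "\<lambda>J. \<lambda>i\<in>top. if i \<in> J then v i else \<zero>"
  have r: "?r J \<in> carrier F" for J
    using v center_set_zero by (auto simp: free_module_def)
  have "q1 (word \<one> [?r J]) \<in> additive_span Q1 unit_words" if "finite J" "J \<subseteq> top" for J
    using that
  proof (induction J)
    case empty
    have "\<zero> \<odot>\<^bsub>F\<^esub> ?r {} = ?r {}" unfolding F_smult by auto
    then have "q1 (word \<one> [?r {}]) = q1 (word \<zero> [?r {}])"
      using q1_smult[OF center_set_zero r[of "{}"]] by simp
    also have "\<dots> = \<zero>\<^bsub>Q1\<^esub>" using Q1h.hom_zero by (simp only: W1_zero)
    finally have "q1 (word \<one> [?r {}]) = \<zero>\<^bsub>Q1\<^esub>" .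
    then show ?case using additive_span.zero[of Q1 unit_words] by (simp only:)
  next
    case (insert j J)
    then have j: "j \<in> top" "J \<subseteq> top" by auto
    have vj: "v j \<in> center_set A" using F_coeff[OF v j(1)] .
    have "?r (insert j J) = ?r J \<oplus>\<^bsub>F\<^esub> (v j \<odot>\<^bsub>F\<^esub> unit_vec j)"
      unfolding F_add F_smult
      using insert.hyps j F_coeff[OF v, THEN center_set_closed]
      by (auto simp: fun_eq_iff unit_vec_def)
    then have "q1 (word \<one> [?r (insert j J)]) = q1 (word \<one> [?r J]) \<oplus>\<^bsub>Q1\<^esub> q1 (word (v j) [unit_vec j])"
      using q1_add[OF r[of J] F_smult_closed[OF vj unit_vec_closed]] q1_smult[OF vj unit_vec_closed]
      by (simp only:)
    moreover have "q1 (word (v j) [unit_vec j]) \<in> additive_span Q1 unit_words"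
      using vj j by (intro additive_span.gen) blast
    ultimately show ?case
      using additive_span.add[OF insert.IH[OF j(2)]] by (simp only:)
  qed
  from this[of top] have "q1 (word \<one> [?r top]) \<in> additive_span Q1 unit_words" by simp
  moreover have "?r top = v" using v by (auto simp: free_module_def PiE_def extensional_def fun_eq_iff)
  ultimately show ?thesis by (simp only:)
qed

lemma word_in_span:
  assumes "w \<in> lists (carrier F)" "c \<in> center_set A"
  shows "q1 (word c w) \<in> additive_span Q1 basis_words"
  using assms(1)
proof (induction w)
  case Nil
  have "[] \<in> increasing" by (simp add: increasing_def)
  then show ?case using assms(2) by (intro additive_span.gen CollectI exI[of _ c] exI[of _ "[]"]) simp
next
  case (Cons v w)
  have "q1 (word c (v # w)) = q1 (word \<one> [v]) \<otimes>\<^bsub>Q1\<^esub> q1 (word c w)"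
    using word_Cons[of \<one> c v w] Cons.hyps assms(2) by (simp add: one_center center_right_one)
  moreover have "\<dots> \<in> additive_span Q1 basis_words"
  proof (rule Q1h.S.additive_span_mult[OF unit_words_closed basis_words_closed _ vector_in_span[OF Cons.hyps(1)] Cons.IH])
    fix x y assume "x \<in> unit_words" "y \<in> basis_words"
    then obtain d i e xs where x: "d \<in> center_set A" "i \<in> top" "x = q1 (word d [unit_vec i])"
      and y: "e \<in> center_set A" "xs \<in> increasing" "y = q1 (word e (map unit_vec xs))" by blast
    have de: "d \<otimes> e \<in> center_set A" using x(1) y(1) by (rule center_set_mult)
    have "x \<otimes>\<^bsub>Q1\<^esub> y = q1 (word (d \<otimes> e) (unit_vec i # map unit_vec xs))"
      unfolding x(3) y(3) by (rule word_Cons[OF x(1) y(1) unit_vec_closed unit_word])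
    then have "x \<otimes>\<^bsub>Q1\<^esub> y \<in> basis_words"
      using insert_into_increasing[OF x(2) y(2) de] by blast
    then show "x \<otimes>\<^bsub>Q1\<^esub> y \<in> additive_span Q1 basis_words" by (rule additive_span.gen)
  qed
  ultimately show ?case by (simp only:)
qed

lemma Q1_spanned:
  assumes "b \<in> carrier Q1"
  shows "b \<in> additive_span Q1 basis_words"
proof -
  obtain x where x: "x \<in> carrier W1" "b = q1 x"
    using assms unfolding I1.quotient_carrier by blast
  from x(1) have "q1 x \<in> additive_span Q1 basis_words"
  proof (induction x rule: W1_induct)
    case zero
    show ?case unfolding Q1h.hom_zero by (rule additive_span.zero)
  next
    case (mono w)
    then show ?case
      using word_in_span[of w "x w"] \<phi>.carrier_coeff[unfolded W1_eq, OF x(1), of w] by simp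
  next
    case (add g h)
    show ?case unfolding Q1h.hom_add[OF add(1,2)] using add(3,4) by (rule additive_span.add)
  qed
  then show ?thesis using x(2) by simp
qed

section \<open>The exterior ring is the exterior algebra on its standard basis\<close>

lemma word_scalar_mult:
  assumes c: "c \<in> center_set A" and x: "x \<in> carrier W1"
  shows "c \<odot>\<^bsub>W1\<^esub> x = word c [] \<otimes>\<^bsub>W1\<^esub> x"
  using x
proof (induction x rule: W1_induct)
  case zero
  have "c \<odot>\<^bsub>W1\<^esub> \<zero>\<^bsub>W1\<^esub> = \<zero>\<^bsub>W1\<^esub>"
    using center_set_closed[OF c] by (simp add: monoid_algebra_def)
  then show ?case using W1_monomial[OF c, of "[]"] by simp
next
  case (mono w)
  then show ?case
    using c \<phi>.carrier_coeff[unfolded W1_eq, OF x, of w] by (simp add: word_smult word_mult)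
next
  case (add g h)
  have "g w \<in> carrier A" "h w \<in> carrier A" for w
    using \<phi>.carrier_coeff[unfolded W1_eq, OF add(1), of w]
      \<phi>.carrier_coeff[unfolded W1_eq, OF add(2), of w] by (auto dest: center_set_closed)
  then have "c \<odot>\<^bsub>W1\<^esub> (g \<oplus>\<^bsub>W1\<^esub> h) = c \<odot>\<^bsub>W1\<^esub> g \<oplus>\<^bsub>W1\<^esub> c \<odot>\<^bsub>W1\<^esub> h"
    using center_set_closed[OF c] by (simp add: monoid_algebra_def r_distr)
  then show ?case
    using add W1_monomial[OF c, of "[]"] by (simp add: W1.r_distr)
qed

abbreviation B where "B \<equiv> exterior_algebra C F"

lemma B_simps:
  "carrier B = carrier Q1" "x \<otimes>\<^bsub>B\<^esub> y = x \<otimes>\<^bsub>Q1\<^esub> y" "\<one>\<^bsub>B\<^esub> = \<one>\<^bsub>Q1\<^esub>" "x \<oplus>\<^bsub>B\<^esub> y = x \<oplus>\<^bsub>Q1\<^esub> y"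
  by (simp_all add: exterior_algebra_def quotient_algebra_def Let_def)

lemma B_smult:
  assumes "c \<in> center_set A" "x \<in> carrier W1"
  shows "c \<odot>\<^bsub>B\<^esub> q1 x = q1 (word c [] \<otimes>\<^bsub>W1\<^esub> x)"
proof -
  have "c \<odot>\<^bsub>B\<^esub> q1 x = (\<Union>y\<in>q1 x. q1 (c \<odot>\<^bsub>W1\<^esub> y))"
    by (simp add: exterior_algebra_def quotient_algebra_def Let_def)
  also have "\<dots> = q1 (c \<odot>\<^bsub>W1\<^esub> x)"
    by (rule I1.quotient_smult[OF W1_monomial[OF assms(1), of "[]"] assms(2)])
      (simp_all add: word_scalar_mult assms(1))
  also have "\<dots> = q1 (word c [] \<otimes>\<^bsub>W1\<^esub> x)" using assms by (simp add: word_scalar_mult)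
  finally show ?thesis .
qed

abbreviation \<phi>b where "\<phi>b \<equiv> induced \<phi>"

lemma \<phi>b_coset: "x \<in> carrier W1 \<Longrightarrow> \<phi>b (q1 x) = \<phi> x"
  using \<phi>h.induced_coset[OF I1.ideal_axioms]
    W1.genideal_minimal[OF \<phi>h.kernel_is_ideal exterior_relations_kernel] by blast

lemma B_cases:
  assumes "b \<in> carrier B"
  obtains x where "x \<in> carrier W1" "b = q1 x"
  using assms unfolding B_simps I1.quotient_carrier by blast

lemma \<phi>b_closed: "b \<in> carrier B \<Longrightarrow> \<phi>b b \<in> carrier E"
  by (erule B_cases) (simp add: \<phi>b_coset)

lemma \<phi>b_add: "\<lbrakk>b \<in> carrier B; b' \<in> carrier B\<rbrakk> \<Longrightarrow> \<phi>b (b \<oplus>\<^bsub>B\<^esub> b') = \<phi>b b \<oplus>\<^bsub>E\<^esub> \<phi>b b'"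
  by (elim B_cases) (simp add: \<phi>b_coset B_simps Q1h.hom_add[symmetric] del: Q1h.hom_add)

lemma \<phi>b_mult: "\<lbrakk>b \<in> carrier B; b' \<in> carrier B\<rbrakk> \<Longrightarrow> \<phi>b (b \<otimes>\<^bsub>B\<^esub> b') = \<phi>b b \<otimes>\<^bsub>E\<^esub> \<phi>b b'"
  by (elim B_cases) (simp add: \<phi>b_coset B_simps Q1h.hom_mult[symmetric] del: Q1h.hom_mult)

lemma \<phi>b_one: "\<phi>b \<one>\<^bsub>B\<^esub> = \<one>\<^bsub>E\<^esub>"
  using \<phi>b_coset[OF W1.one_closed] by (simp add: B_simps Q1h.hom_one[symmetric] del: Q1h.hom_one)

lemma \<phi>_scalar: "c \<in> center_set A \<Longrightarrow> \<phi> (word c []) = monomial A c {}"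
  using \<phi>_monomial[of c "[]"] by (simp add: word_product_def monomial_closed_E center_set_closed)

lemma B_smult_closed: "\<lbrakk>c \<in> center_set A; b \<in> carrier B\<rbrakk> \<Longrightarrow> c \<odot>\<^bsub>B\<^esub> b \<in> carrier B"
  using W1_monomial[of c "[]"] by (elim B_cases) (simp add: B_smult B_simps)

lemma \<phi>b_smult:
  assumes "c \<in> center_set A" "b \<in> carrier B"
  shows "\<phi>b (c \<odot>\<^bsub>B\<^esub> b) = monomial A c {} \<otimes>\<^bsub>E\<^esub> \<phi>b b"
  using assms(2)
proof (rule B_cases)
  fix x assume x: "x \<in> carrier W1" "b = q1 x"
  note w = W1_monomial[OF assms(1), of "[]", simplified]
  have "\<phi>b (c \<odot>\<^bsub>B\<^esub> b) = \<phi> (word c [] \<otimes>\<^bsub>W1\<^esub> x)"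
    unfolding x(2) B_smult[OF assms(1) x(1)] using w x(1) by (intro \<phi>b_coset) simp
  also have "\<dots> = monomial A c {} \<otimes>\<^bsub>E\<^esub> \<phi>b b"
    using w x assms(1) by (simp add: \<phi>_scalar \<phi>b_coset)
  finally show ?thesis .
qed

lemma \<phi>_commute:
  assumes a: "a \<in> carrier A" and x: "x \<in> carrier W1"
  shows "monomial A a {} \<otimes>\<^bsub>E\<^esub> \<phi> x = \<phi> x \<otimes>\<^bsub>E\<^esub> monomial A a {}"
  using x
proof (induction x rule: W1_induct)
  case zero
  then show ?case using a by (simp add: monomial_closed_E)
next
  case (add g h)
  then show ?case using a by (simp add: monomial_closed_E L.l_distr L.r_distr)
next
  case (mono w)
  have c: "x w \<in> center_set A" using \<phi>.carrier_coeff[unfolded W1_eq, OF x, of w] by simp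
  have w: "w \<in> lists (carrier F)" using mono by simp
  let ?a = "monomial A a {}" and ?c = "monomial A (x w) {}" and ?w = "word_product w"
  have carr: "?a \<in> carrier E" "?c \<in> carrier E" "?w \<in> carrier E"
    using a c w by (simp_all add: monomial_closed_E center_set_closed word_product_closed)
  have ac: "?a \<otimes>\<^bsub>E\<^esub> ?c = ?c \<otimes>\<^bsub>E\<^esub> ?a"
    using center_set_commute[OF scalar_central[OF c] carr(1)] by simp
  have "?a \<otimes>\<^bsub>E\<^esub> (?c \<otimes>\<^bsub>E\<^esub> ?w) = ?c \<otimes>\<^bsub>E\<^esub> (?a \<otimes>\<^bsub>E\<^esub> ?w)"
    using carr ac by (simp add: L.m_assoc[symmetric])
  also have "\<dots> = (?c \<otimes>\<^bsub>E\<^esub> ?w) \<otimes>\<^bsub>E\<^esub> ?a"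
    using carr word_product_commute[OF w a] by (simp add: L.m_assoc)
  finally show ?case using \<phi>_monomial[OF c w] by simp
qed

abbreviation AM where "AM \<equiv> center_module A"

lemma AM_simps: "carrier AM = carrier A" "x \<otimes>\<^bsub>AM\<^esub> y = x \<otimes> y" "\<one>\<^bsub>AM\<^esub> = \<one>" "x \<oplus>\<^bsub>AM\<^esub> y = x \<oplus> y"
  "c \<odot>\<^bsub>AM\<^esub> x = x \<otimes> c"
  by (simp_all add: center_module_def)

text \<open>The image of the pure tensor \<open>a \<otimes> b\<close>.\<close>

definition pair_product :: "'a \<times> ((nat \<Rightarrow> 'a) list \<Rightarrow> 'a) set \<Rightarrow> nat set \<Rightarrow> 'a"
  where "pair_product p = monomial A (fst p) {} \<otimes>\<^bsub>E\<^esub> \<phi>b (snd p)"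

lemma monoid_pairs: "monoid (AM \<times>\<times> B)"
proof (rule DirProd_monoid)
  show "monoid AM" by (rule monoidI) (auto simp: AM_simps m_assoc)
  show "monoid B" by (rule monoidI) (auto simp: B_simps Q1h.S.m_assoc)
qed

lemma int_multiple_hom: "(\<lambda>k::int. [k] \<cdot>\<^bsub>E\<^esub> \<one>\<^bsub>E\<^esub>) \<in> ring_hom \<Z> E"
proof (rule ring_hom_memI)
  fix k l :: int
  show "[(k \<otimes>\<^bsub>\<Z>\<^esub> l)] \<cdot>\<^bsub>E\<^esub> \<one>\<^bsub>E\<^esub> = [k] \<cdot>\<^bsub>E\<^esub> \<one>\<^bsub>E\<^esub> \<otimes>\<^bsub>E\<^esub> [l] \<cdot>\<^bsub>E\<^esub> \<one>\<^bsub>E\<^esub>"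
    by (simp add: L.add_pow_ldistr_int L.add.int_pow_pow mult.commute)
  show "[(k \<oplus>\<^bsub>\<Z>\<^esub> l)] \<cdot>\<^bsub>E\<^esub> \<one>\<^bsub>E\<^esub> = [k] \<cdot>\<^bsub>E\<^esub> \<one>\<^bsub>E\<^esub> \<oplus>\<^bsub>E\<^esub> [l] \<cdot>\<^bsub>E\<^esub> \<one>\<^bsub>E\<^esub>"
    by (simp add: L.add.int_pow_mult)
qed simp_all

text \<open>Multiplicativity on pairs, \<open>a a' \<phi>(b b') = a \<phi>(b) a' \<phi>(b')\<close>, holds because \<open>\<phi>\<close> takes values with
central coefficients, which commute with the constants \<open>a'\<close>.\<close>

sublocale \<psi>: monoid_algebra_map \<Z> "AM \<times>\<times> B" E "\<lambda>k. [k] \<cdot>\<^bsub>E\<^esub> \<one>\<^bsub>E\<^esub>" pair_product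
proof (intro monoid_algebra_map.intro monoid_algebra_map_axioms.intro)
  show "ring \<Z>" using int_is_cring by (rule cring.axioms)
  show "monoid (AM \<times>\<times> B)" by (rule monoid_pairs)
  show "ring E" by (rule L.ring_axioms)
  show "(\<lambda>k::int. [k] \<cdot>\<^bsub>E\<^esub> \<one>\<^bsub>E\<^esub>) \<in> ring_hom \<Z> E" by (rule int_multiple_hom)
  show closed: "pair_product p \<in> carrier E" if "p \<in> carrier (AM \<times>\<times> B)" for p
    using that by (auto simp: pair_product_def AM_simps \<phi>b_closed monomial_closed_E)
  show "pair_product \<one>\<^bsub>AM \<times>\<times> B\<^esub> = \<one>\<^bsub>E\<^esub>"
    by (simp add: pair_product_def AM_simps \<phi>b_one E_one[symmetric])
  show "[k] \<cdot>\<^bsub>E\<^esub> \<one>\<^bsub>E\<^esub> \<otimes>\<^bsub>E\<^esub> pair_product p = pair_product p \<otimes>\<^bsub>E\<^esub> [k] \<cdot>\<^bsub>E\<^esub> \<one>\<^bsub>E\<^esub>"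
    if "p \<in> carrier (AM \<times>\<times> B)" for k :: int and p
    using closed[OF that] by (simp add: L.add_pow_ldistr_int L.add_pow_rdistr_int)
  fix p p' assume "p \<in> carrier (AM \<times>\<times> B)" "p' \<in> carrier (AM \<times>\<times> B)"
  then obtain a b a' b' where p: "p = (a, b)" "p' = (a', b')" "a \<in> carrier A" "a' \<in> carrier A"
    "b \<in> carrier B" "b' \<in> carrier B" by (auto simp: AM_simps)
  obtain x where x: "x \<in> carrier W1" "b = q1 x" using p(5) by (rule B_cases)
  let ?a = "monomial A a {}" and ?a' = "monomial A a' {}"
  have carr: "?a \<in> carrier E" "?a' \<in> carrier E" "\<phi>b b \<in> carrier E" "\<phi>b b' \<in> carrier E"
    using p by (simp_all add: monomial_closed_E \<phi>b_closed)
  have comm: "?a' \<otimes>\<^bsub>E\<^esub> \<phi>b b = \<phi>b b \<otimes>\<^bsub>E\<^esub> ?a'"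
    using \<phi>_commute[OF p(4) x(1)] x by (simp add: \<phi>b_coset)
  have "pair_product (p \<otimes>\<^bsub>AM \<times>\<times> B\<^esub> p') = (?a \<otimes>\<^bsub>E\<^esub> ?a') \<otimes>\<^bsub>E\<^esub> (\<phi>b b \<otimes>\<^bsub>E\<^esub> \<phi>b b')"
    using p by (simp add: pair_product_def AM_simps \<phi>b_mult monomial_mult exterior_sign_def)
  also have "\<dots> = ?a \<otimes>\<^bsub>E\<^esub> (?a' \<otimes>\<^bsub>E\<^esub> \<phi>b b) \<otimes>\<^bsub>E\<^esub> \<phi>b b'"
    using carr by (simp add: L.m_assoc)
  also have "\<dots> = pair_product p \<otimes>\<^bsub>E\<^esub> pair_product p'"
    unfolding comm using carr p by (simp add: pair_product_def L.m_assoc)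
  finally show "pair_product (p \<otimes>\<^bsub>AM \<times>\<times> B\<^esub> p') = pair_product p \<otimes>\<^bsub>E\<^esub> pair_product p'" .
qed

text \<open>\<open>Q2\<close> is the tensor product \<open>A \<otimes> \<Lambda>(C\<^sup>n)\<close>, \<open>q2\<close> the projection onto it, and \<open>q2 (pair a b)\<close> the pure
tensor \<open>a \<otimes> b\<close>.\<close>

abbreviation P where "P \<equiv> monoid_algebra \<Z> (AM \<times>\<times> B)"
abbreviation \<psi> where "\<psi> \<equiv> linear_extension \<Z> E (\<lambda>k. [k] \<cdot>\<^bsub>E\<^esub> \<one>\<^bsub>E\<^esub>) pair_product"
abbreviation ten_ideal where "ten_ideal \<equiv> Idl\<^bsub>P\<^esub> (tensor_relations C AM B)"
abbreviation Q2 where "Q2 \<equiv> P Quot ten_ideal"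
abbreviation q2 where "q2 \<equiv> (\<lambda>x. ten_ideal +>\<^bsub>P\<^esub> x)"
abbreviation pair where "pair a b \<equiv> monomial \<Z> 1 (a, b)"

lemma P_eq: "twisted_algebra \<Z> (AM \<times>\<times> B) (\<lambda>_ _ x. x) = P"
  by (simp add: monoid_algebra_eq_twisted)

lemmas P_induct = \<psi>.monomial_induct[unfolded P_eq, consumes 1, case_names zero mono add]
lemmas P_monomial = \<psi>.monomial_closed[unfolded P_eq, simplified AM_simps carrier_DirProd, simplified]
lemmas P_sum = \<psi>.monomial_add[unfolded P_eq, simplified]
lemmas P_zero = \<psi>.monomial_zero[unfolded P_eq, simplified]

lemma ring_P: "ring P"
  using \<psi>.ring_twisted unfolding P_eq .

lemma pair_closed: "\<lbrakk>a \<in> carrier A; b \<in> carrier B\<rbrakk> \<Longrightarrow> pair a b \<in> carrier P"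
  using P_monomial[of "(a, b)" 1] by simp

lemma \<psi>_pair:
  assumes "a \<in> carrier A" "b \<in> carrier B"
  shows "\<psi> (pair a b) = monomial A a {} \<otimes>\<^bsub>E\<^esub> \<phi>b b"
  using \<psi>.extend_monomial[of 1 "(a, b)"] \<psi>.monoid_closed[of "(a, b)"] assms
  by (simp add: AM_simps pair_product_def)

sublocale P: ring P
  by (rule ring_P)

sublocale \<psi>h: ring_hom_ring P E \<psi>
  by (rule ring_hom_ringI2[OF P.ring_axioms L.ring_axioms \<psi>.extend_hom])

lemma tensor_relations_cases:
  assumes "r \<in> tensor_relations C AM B"
  obtains a a' b where "a \<in> carrier A" "a' \<in> carrier A" "b \<in> carrier B"
      "r = pair (a \<oplus> a') b \<ominus>\<^bsub>P\<^esub> (pair a b \<oplus>\<^bsub>P\<^esub> pair a' b)"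
    | a b b' where "a \<in> carrier A" "b \<in> carrier B" "b' \<in> carrier B"
      "r = pair a (b \<oplus>\<^bsub>B\<^esub> b') \<ominus>\<^bsub>P\<^esub> (pair a b \<oplus>\<^bsub>P\<^esub> pair a b')"
    | c a b where "c \<in> center_set A" "a \<in> carrier A" "b \<in> carrier B"
      "r = pair (a \<otimes> c) b \<ominus>\<^bsub>P\<^esub> pair a (c \<odot>\<^bsub>B\<^esub> b)"
  using assms unfolding tensor_relations_def Let_def basis_elt_eq_monomial AM_simps center_ring_simps
  by (elim UnE CollectE exE conjE) (simp_all add: B_simps del: B_simps)

lemma tensor_relations_intros:
  "a \<in> carrier A \<Longrightarrow> a' \<in> carrier A \<Longrightarrow> b \<in> carrier B \<Longrightarrow>
    pair (a \<oplus> a') b \<ominus>\<^bsub>P\<^esub> (pair a b \<oplus>\<^bsub>P\<^esub> pair a' b) \<in> tensor_relations C AM B"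
  "a \<in> carrier A \<Longrightarrow> b \<in> carrier B \<Longrightarrow> b' \<in> carrier B \<Longrightarrow>
    pair a (b \<oplus>\<^bsub>B\<^esub> b') \<ominus>\<^bsub>P\<^esub> (pair a b \<oplus>\<^bsub>P\<^esub> pair a b') \<in> tensor_relations C AM B"
  "c \<in> center_set A \<Longrightarrow> a \<in> carrier A \<Longrightarrow> b \<in> carrier B \<Longrightarrow>
    pair (a \<otimes> c) b \<ominus>\<^bsub>P\<^esub> pair a (c \<odot>\<^bsub>B\<^esub> b) \<in> tensor_relations C AM B"
  unfolding tensor_relations_def Let_def basis_elt_eq_monomial AM_simps center_ring_simps monoid.simps
  by blast+

lemma B_add_closed: "\<lbrakk>b \<in> carrier B; b' \<in> carrier B\<rbrakk> \<Longrightarrow> b \<oplus>\<^bsub>B\<^esub> b' \<in> carrier B"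
  by (simp add: B_simps)

lemma tensor_relations_closed: "tensor_relations C AM B \<subseteq> carrier P"
proof
  fix r assume "r \<in> tensor_relations C AM B"
  then show "r \<in> carrier P"
    by (cases rule: tensor_relations_cases)
      (auto simp: pair_closed B_add_closed B_smult_closed center_set_closed)
qed

lemma tensor_relations_kernel: "tensor_relations C AM B \<subseteq> a_kernel P E \<psi>"
proof
  fix r assume r: "r \<in> tensor_relations C AM B"
  then have "\<psi> r = \<zero>\<^bsub>E\<^esub>"
  proof (cases rule: tensor_relations_cases)
    case (1 a a' b)
    then show ?thesis
      by (simp add: P.minus_eq pair_closed \<psi>_pair \<phi>b_closed monomial_add_E monomial_closed_E L.l_distr L.r_neg)
  next
    case (2 a b b')
    then show ?thesis
      by (simp add: P.minus_eq pair_closed B_add_closed \<psi>_pair \<phi>b_add \<phi>b_closed monomial_closed_E L.r_distr L.r_neg)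
  next
    case (3 c a b)
    note c = center_set_closed[OF 3(1)]
    have "monomial A (a \<otimes> c) {} = monomial A a {} \<otimes>\<^bsub>E\<^esub> monomial A c {}"
      using 3 c by (simp add: monomial_mult exterior_sign_def)
    then show ?thesis
      using 3 c by (simp add: P.minus_eq pair_closed B_smult_closed \<psi>_pair \<phi>b_smult \<phi>b_closed monomial_closed_E
        L.m_assoc L.r_neg)
  qed
  then show "r \<in> a_kernel P E \<psi>"
    unfolding a_kernel_def' using subsetD[OF tensor_relations_closed r] by blast
qed

sublocale I2: ideal ten_ideal P
  using tensor_relations_closed by (rule P.genideal_ideal)

sublocale Q2h: ring_hom_ring P Q2 q2
  by (rule I2.rcos_ring_hom_ring)

lemma ten_ideal_relation: "r \<in> tensor_relations C AM B \<Longrightarrow> r \<in> ten_ideal"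
  using P.genideal_self[OF tensor_relations_closed] by blast

lemma q2_pair_closed: "\<lbrakk>a \<in> carrier A; b \<in> carrier B\<rbrakk> \<Longrightarrow> q2 (pair a b) \<in> carrier Q2"
  by (rule Q2h.hom_closed[OF pair_closed])

lemma q2_add_left:
  assumes "a \<in> carrier A" "a' \<in> carrier A" "b \<in> carrier B"
  shows "q2 (pair (a \<oplus> a') b) = q2 (pair a b) \<oplus>\<^bsub>Q2\<^esub> q2 (pair a' b)"
proof -
  have "q2 (pair (a \<oplus> a') b) = q2 (pair a b \<oplus>\<^bsub>P\<^esub> pair a' b)"
    by (rule I2.quotient_eqI[OF ten_ideal_relation[OF tensor_relations_intros(1)[OF assms]]])
      (use assms in \<open>simp_all add: pair_closed\<close>)
  then show ?thesis using assms by (simp add: pair_closed)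
qed

lemma q2_add_right:
  assumes "a \<in> carrier A" "b \<in> carrier B" "b' \<in> carrier B"
  shows "q2 (pair a (b \<oplus>\<^bsub>B\<^esub> b')) = q2 (pair a b) \<oplus>\<^bsub>Q2\<^esub> q2 (pair a b')"
proof -
  have "q2 (pair a (b \<oplus>\<^bsub>B\<^esub> b')) = q2 (pair a b \<oplus>\<^bsub>P\<^esub> pair a b')"
    by (rule I2.quotient_eqI[OF ten_ideal_relation[OF tensor_relations_intros(2)[OF assms]]])
      (use assms in \<open>simp_all add: pair_closed B_add_closed\<close>)
  then show ?thesis using assms by (simp add: pair_closed)
qed

lemma q2_balanced:
  assumes "c \<in> center_set A" "a \<in> carrier A" "b \<in> carrier B"
  shows "q2 (pair a (c \<odot>\<^bsub>B\<^esub> b)) = q2 (pair (a \<otimes> c) b)"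
  by (rule I2.quotient_eqI[OF ten_ideal_relation[OF tensor_relations_intros(3)[OF assms]], symmetric])
    (use assms in \<open>simp_all add: pair_closed B_smult_closed center_set_closed\<close>)

definition basis_vector :: "nat set \<Rightarrow> ((nat \<Rightarrow> 'a) list \<Rightarrow> 'a) set"
  where "basis_vector S = q1 (word \<one> (map unit_vec (sorted_list_of_set S)))"

text \<open>The additive map \<open>f \<mapsto> \<Sum> f(S) \<otimes> e\<^sub>S\<close>, which will turn out to be the inverse of the isomorphism.\<close>

definition section_map :: "(nat set \<Rightarrow> 'a) \<Rightarrow> ('a \<times> ((nat \<Rightarrow> 'a) list \<Rightarrow> 'a) set \<Rightarrow> int) set"
  where "section_map f = (\<Oplus>\<^bsub>Q2\<^esub>S\<in>Pow top. q2 (pair (f S) (basis_vector S)))"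

lemma basis_vector_closed: "basis_vector S \<in> carrier B"
  unfolding basis_vector_def B_simps by (rule Q1h.hom_closed[OF W1_monomial[OF one_center unit_word]])

lemma sorted_list_increasing: "S \<subseteq> top \<Longrightarrow> sorted_list_of_set S \<in> increasing"
  using finite_subset[of S top] by (auto simp: increasing_def)

lemma \<phi>b_basis_vector:
  assumes "S \<subseteq> top"
  shows "\<phi>b (basis_vector S) = monomial A \<one> S"
proof -
  have "finite S" using assms finite_subset by blast
  then have "word_product (map unit_vec (sorted_list_of_set S)) = monomial A \<one> S"
    using word_product_increasing[OF sorted_list_increasing[OF assms]] by simp
  then show ?thesis
    unfolding basis_vector_def \<phi>b_coset[OF W1_monomial[OF one_center unit_word]] \<phi>_monomial[OF one_center unit_word]
    using assms by (simp add: E_one[symmetric] monomial_closed_E)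
qed

lemma section_add:
  assumes f: "f \<in> carrier E" and g: "g \<in> carrier E"
  shows "section_map (f \<oplus>\<^bsub>E\<^esub> g) = section_map f \<oplus>\<^bsub>Q2\<^esub> section_map g"
proof -
  have "section_map (f \<oplus>\<^bsub>E\<^esub> g) =
    (\<Oplus>\<^bsub>Q2\<^esub>S\<in>Pow top. q2 (pair (f S) (basis_vector S)) \<oplus>\<^bsub>Q2\<^esub> q2 (pair (g S) (basis_vector S)))"
    unfolding section_map_def E_add
    using coeff[OF f] coeff[OF g]
    by (intro Q2h.S.finsum_cong' refl) (simp_all add: q2_add_left basis_vector_closed q2_pair_closed)
  also have "\<dots> = section_map f \<oplus>\<^bsub>Q2\<^esub> section_map g"
    unfolding section_map_def
    using coeff[OF f] coeff[OF g]
    by (intro Q2h.S.finsum_addf) (auto simp: basis_vector_closed q2_pair_closed)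
  finally show ?thesis .
qed

lemma section_closed: "f \<in> carrier E \<Longrightarrow> section_map f \<in> carrier Q2"
  unfolding section_map_def using coeff[of f]
  by (intro Q2h.S.finsum_closed) (auto simp: basis_vector_closed q2_pair_closed)

lemma section_zero: "section_map \<zero>\<^bsub>E\<^esub> = \<zero>\<^bsub>Q2\<^esub>"
  using section_add[OF L.zero_closed L.zero_closed] section_closed[OF L.zero_closed]
  by (simp add: Q2h.S.add.l_cancel_one)

lemma section_minus: "f \<in> carrier E \<Longrightarrow> section_map (\<ominus>\<^bsub>E\<^esub> f) = \<ominus>\<^bsub>Q2\<^esub> section_map f"
  using section_add[of "\<ominus>\<^bsub>E\<^esub> f" f]
  by (simp add: L.l_neg section_zero section_closed Q2h.S.minus_equality)

lemma q2_zero_left: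
  assumes "b \<in> carrier B"
  shows "q2 (pair \<zero> b) = \<zero>\<^bsub>Q2\<^esub>"
  using q2_add_left[OF zero_closed zero_closed assms] q2_pair_closed[OF zero_closed assms]
  by (simp add: Q2h.S.add.l_cancel_one)

lemma section_monomial:
  assumes a: "a \<in> carrier A" and S: "S \<subseteq> top"
  shows "section_map (monomial A a S) = q2 (pair a (basis_vector S))"
proof -
  have "section_map (monomial A a S) =
    (\<Oplus>\<^bsub>Q2\<^esub>U\<in>Pow top. if S = U then q2 (pair a (basis_vector U)) else \<zero>\<^bsub>Q2\<^esub>)"
    unfolding section_map_def
    using a by (intro Q2h.S.finsum_cong' refl)
      (auto simp: monomial_apply_neq q2_zero_left basis_vector_closed q2_pair_closed)
  also have "\<dots> = q2 (pair a (basis_vector S))"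
    using a S by (intro Q2h.S.finsum_singleton) (auto simp: basis_vector_closed q2_pair_closed)
  finally show ?thesis .
qed

text \<open>Both sides are additive in \<open>b\<close>, and \<open>\<Lambda>(C\<^sup>n)\<close> is spanned by the elements \<open>c e\<^sub>S\<close>. For these the balancing
relation gives \<open>a \<otimes> c e\<^sub>S = a c \<otimes> e\<^sub>S\<close>.\<close>

lemma section_pair:
  assumes a: "a \<in> carrier A" and b: "b \<in> carrier B"
  shows "q2 (pair a b) = section_map (\<psi> (pair a b))"
proof -
  have "b \<in> additive_span Q1 basis_words" using b Q1_spanned by (simp add: B_simps)
  then have "q2 (pair a b) = section_map (monomial A a {} \<otimes>\<^bsub>E\<^esub> \<phi>b b)"
  proof induction
    case zero
    have z: "\<zero>\<^bsub>Q1\<^esub> \<in> carrier B" by (simp add: B_simps)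
    have zz: "\<zero>\<^bsub>Q1\<^esub> \<oplus>\<^bsub>B\<^esub> \<zero>\<^bsub>Q1\<^esub> = \<zero>\<^bsub>Q1\<^esub>" by (simp add: B_simps)
    have "q2 (pair a \<zero>\<^bsub>Q1\<^esub>) = \<zero>\<^bsub>Q2\<^esub>"
      using q2_add_right[OF a z z] q2_pair_closed[OF a z] unfolding zz by (simp add: Q2h.S.add.l_cancel_one)
    moreover have "\<phi>b \<zero>\<^bsub>Q1\<^esub> = \<zero>\<^bsub>E\<^esub>"
      using \<phi>b_add[OF z z] \<phi>b_closed[OF z] unfolding zz by (simp add: L.add.l_cancel_one)
    ultimately show ?case using a by (simp add: monomial_closed_E section_zero)
  next
    case (gen b)
    then obtain c xs where c: "c \<in> center_set A" "xs \<in> increasing" "b = q1 (word c (map unit_vec xs))"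
      by blast
    let ?S = "set xs"
    have S: "?S \<subseteq> top" using c(2) by (simp add: increasing_def)
    have "sorted_list_of_set ?S = xs"
      using c(2) by (simp add: increasing_def strict_sorted_iff sorted_list_of_set.idem_if_sorted_distinct)
    then have "basis_vector ?S = q1 (word \<one> (map unit_vec xs))" by (simp add: basis_vector_def)
    then have b: "b = c \<odot>\<^bsub>B\<^esub> basis_vector ?S"
      using B_smult[OF c(1) W1_monomial[OF one_center unit_word, of xs]]
        word_mult[OF c(1) one_center, of "[]" "map unit_vec xs"] unit_word[of xs] c
      by (simp add: center_right_one)
    have "q2 (pair a b) = q2 (pair (a \<otimes> c) (basis_vector ?S))"
      unfolding b by (rule q2_balanced[OF c(1) a basis_vector_closed])
    also have "\<dots> = section_map (monomial A (a \<otimes> c) ?S)"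
      using a center_set_closed[OF c(1)] S by (simp add: section_monomial)
    also have "monomial A (a \<otimes> c) ?S = monomial A a {} \<otimes>\<^bsub>E\<^esub> \<phi>b b"
      unfolding b \<phi>b_smult[OF c(1) basis_vector_closed] \<phi>b_basis_vector[OF S]
      using a center_set_closed[OF c(1)] S by (simp add: monomial_mult exterior_sign_def)
    finally show ?case .
  next
    case (add x y)
    have "basis_words \<subseteq> carrier Q1" by (rule basis_words_closed)
    then have B: "x \<in> carrier B" "y \<in> carrier B"
      using add(1,2) Q1h.S.additive_span_closed unfolding B_simps by blast+
    have "q2 (pair a (x \<oplus>\<^bsub>B\<^esub> y)) = section_map (monomial A a {} \<otimes>\<^bsub>E\<^esub> \<phi>b (x \<oplus>\<^bsub>B\<^esub> y))"
      using B a add(3,4) by (simp add: q2_add_right \<phi>b_add L.r_distr monomial_closed_E \<phi>b_closed section_add)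
    then show ?case by (simp add: B_simps)
  qed
  then show ?thesis using a b by (simp add: \<psi>_pair)
qed

text \<open>Every class is recovered from its image, so the kernel contains nothing but the relations. No
multiplicativity of \<open>section_map\<close> is involved: pure tensors generate additively, and integer
multiples are reached by repeated addition and subtraction.\<close>

lemma section_\<psi>:
  assumes "t \<in> carrier P"
  shows "q2 t = section_map (\<psi> t)"
proof -
  define H where "H = {t \<in> carrier P. q2 t = section_map (\<psi> t)}"
  have H_zero: "\<zero>\<^bsub>P\<^esub> \<in> H" by (simp add: H_def section_zero)
  have H_add: "x \<oplus>\<^bsub>P\<^esub> y \<in> H" if "x \<in> H" "y \<in> H" for x y
    using that by (simp add: H_def section_add)
  have H_minus: "\<ominus>\<^bsub>P\<^esub> x \<in> H" if "x \<in> H" for x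
    using that by (simp add: H_def section_minus)
  have H_mono: "monomial \<Z> k p \<in> H" if p: "p \<in> carrier AM \<times> carrier B" for k :: int and p
  proof -
    have one: "monomial \<Z> 1 p \<in> H"
      using p section_pair pair_closed by (auto simp: H_def AM_simps)
    have "monomial \<Z> (- 1) p \<oplus>\<^bsub>P\<^esub> monomial \<Z> 1 p = \<zero>\<^bsub>P\<^esub>"
      using P_sum[of "-1" 1 p] P_zero[of p] by simp
    then have "monomial \<Z> (- 1) p = \<ominus>\<^bsub>P\<^esub> monomial \<Z> 1 p"
      using P_monomial[of p] p by (intro P.minus_equality[symmetric]) (auto simp: AM_simps)
    then have minus_one: "monomial \<Z> (- 1) p \<in> H" using H_minus[OF one] by simp
    show ?thesis
    proof (induction k rule: int_induct[where k = 0])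
      case base
      then show ?case using H_zero P_zero[of p] by simp
    next
      case (step1 k)
      then show ?case using P_sum[of k 1 p] H_add[OF _ one] by simp
    next
      case (step2 k)
      then show ?case using P_sum[of k "- 1" p] H_add[OF _ minus_one] by simp
    qed
  qed
  from assms have "t \<in> H"
  proof (induction t rule: P_induct)
    case zero
    show ?case by (rule H_zero)
  next
    case (mono w)
    then show ?case by (intro H_mono) simp
  next
    case (add g h)
    then show ?case by (intro H_add)
  qed
  then show ?thesis by (simp add: H_def)
qed

lemma \<psi>_kernel: "a_kernel P E \<psi> = ten_ideal"
proof
  show "ten_ideal \<subseteq> a_kernel P E \<psi>"
    by (rule P.genideal_minimal[OF \<psi>h.kernel_is_ideal tensor_relations_kernel])
  show "a_kernel P E \<psi> \<subseteq> ten_ideal"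
  proof
    fix t assume "t \<in> a_kernel P E \<psi>"
    then have t: "t \<in> carrier P" "\<psi> t = \<zero>\<^bsub>E\<^esub>" unfolding a_kernel_def' by blast+
    have "q2 t = \<zero>\<^bsub>Q2\<^esub>" using section_\<psi>[OF t(1)] t(2) section_zero by simp
    then show "t \<in> ten_ideal" using I2.quotient_zero_iff[OF t(1)] by blast
  qed
qed

lemma \<psi>_surjective: "\<psi> ` carrier P = carrier E"
proof
  show "\<psi> ` carrier P \<subseteq> carrier E" by (rule image_subsetI) (rule \<psi>h.hom_closed)
  show "carrier E \<subseteq> \<psi> ` carrier P"
  proof
    fix f assume f: "f \<in> carrier E"
    then show "f \<in> \<psi> ` carrier P"
    proof (induction f rule: E_induct)
      case zero
      show ?case by (rule image_eqI[of _ _ "\<zero>\<^bsub>P\<^esub>"]) simp_all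
    next
      case (mono S)
      then have S: "S \<subseteq> top" by simp
      have "\<psi> (pair (f S) (basis_vector S)) = monomial A (f S) S"
        using S coeff[OF f] by (simp add: \<psi>_pair basis_vector_closed \<phi>b_basis_vector monomial_mult exterior_sign_def)
      then show ?case
        by (rule image_eqI[OF sym pair_closed[OF coeff[OF f] basis_vector_closed]])
    next
      case (add g h)
      then obtain x y where "x \<in> carrier P" "g = \<psi> x" "y \<in> carrier P" "h = \<psi> y" by blast
      then have "g \<oplus>\<^bsub>E\<^esub> h = \<psi> (x \<oplus>\<^bsub>P\<^esub> y)" "x \<oplus>\<^bsub>P\<^esub> y \<in> carrier P"
        by (simp_all only: \<psi>h.hom_add P.a_closed)
      then show ?case by (rule image_eqI)
    qed
  qed
qed

lemma exterior_ring_eq: "exterior_ring A n = Q2"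
  by (simp add: exterior_ring_def tensor_ring_def Let_def)

theorem exterior_ring_iso: "\<exists>h. h \<in> ring_iso (exterior_ring A n) E"
  using \<psi>h.FactRing_iso_set[OF \<psi>_surjective] unfolding \<psi>_kernel exterior_ring_eq by blast

end

theorem theorem1p3:
  fixes A :: "('a, 'm) ring_scheme" and n :: nat
  assumes "ring A" and "n \<ge> 1"
  shows "centrally_essential (exterior_ring A n) \<longleftrightarrow>
    centrally_essential A \<and>
    (essential_submodule (annihilator_of_two A) (center_ring A) (center_module A) \<or> odd n)"
proof -
  interpret exterior A n using assms(1) by (simp add: exterior_def)
  obtain h where h: "h \<in> ring_iso (exterior_ring A n) E" using exterior_ring_iso by blast
  have R: "ring (exterior_ring A n)" unfolding exterior_ring_eq by (rule Q2h.S.ring_axioms)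
  have "centrally_essential (exterior_ring A n) \<longleftrightarrow> centrally_essential E"
    using centrally_essential_ring_iso[OF R L.ring_axioms h]
      centrally_essential_ring_iso[OF L.ring_axioms R ring_iso_set_sym[OF R h]] by blast
  then show ?thesis using E_centrally_essential_iff[OF assms(2)] by simp
qed

end
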